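(* Let $H$ be a complex Hilbert space and let $p$ be a one variable complex polynomial. If $N$ is a densely defined closable linear operator in $H$ such that its closure $\overline{N}$ is normal, and if $A$ is a densely defined linear operator in $H$ with $\sigma[p(A)]\neq\mathbb{C}$, then \[NA\subset AN\Longrightarrow N^*A\subset AN^*\] whenever $D(A)\subset D(N)$.
   Context: Operators in $H$ are linear, not necessarily bounded, and defined on a linear subspace (the domain $D(\cdot)$) of $H$; $B(H)$ denotes the bounded linear operators defined on all of $H$. $S\subset T$ means $D(S)\subset D(T)$ and $Sx=Tx$ for all $x\in D(S)$. Products and sums have their natural domains: $D(ST)=\{x\in D(T): Tx\in D(S)\}$ and $D(S+T)=D(S)\cap D(T)$; $p(A)$ is formed accordingly. An operator is closed if its graph is closed in $H\oplus H$; it is closable if it has a closed extension, and its closure $\overline{T}$ is then its smallest closed extension. $T^*$ denotes the adjoint of a densely defined operator $T$. A densely defined operator $T$ is normal if it is closed and $TT^*=T^*T$ (with equality of domains). The resolvent set of an operator $T$ is $\rho(T)=\{\lambda\in\mathbb{C}: \lambda I-T \text{ is bijective from } D(T) \text{ onto } H \text{ and } (\lambda I-T)^{-1}\in B(H)\}$, and the spectrum is $\sigma(T)=\mathbb{C}\setminus\rho(T)$.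
   Formalization: The polynomial p is assumed non-constant; for constant p, p(A)=cI makes the spectral condition void and the claim fails, e.g. N = multiplication by z on L²(circle), A = identity on {qg: q polynomial}, g=exp(-1/|t|). *)

theory Defs
  imports "HOL-Analysis.Analysis" "HOL-Computational_Algebra.Polynomial"
begin

section \<open>Complex Hilbert spaces\<close>

text \<open>
  A complex Hilbert space is a complete real inner product space that carries in addition a
  complex scalar multiplication extending the real one, and a complex inner product (linear in
  the first argument) whose real part is the real inner product. Norm and topology are thus the
  ones given by the complex inner product, since \<open>norm x = sqrt (Re (cinner x x))\<close>.
\<close>

class complex_hilbert_space = real_inner + complete_space +
  fixes scaleC :: "complex \<Rightarrow> 'a \<Rightarrow> 'a"  (infixr \<open>*\<^sub>C\<close> 75)
    and cinner :: "'a \<Rightarrow> 'a \<Rightarrow> complex"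
  assumes scaleC_add_right: "c *\<^sub>C (x + y) = c *\<^sub>C x + c *\<^sub>C y"
    and scaleC_add_left: "(c + d) *\<^sub>C x = c *\<^sub>C x + d *\<^sub>C x"
    and scaleC_scaleC: "c *\<^sub>C d *\<^sub>C x = (c * d) *\<^sub>C x"
    and scaleC_of_real: "complex_of_real r *\<^sub>C x = r *\<^sub>R x"
    and cinner_commute: "cinner x y = cnj (cinner y x)"
    and cinner_add_left: "cinner (x + y) z = cinner x z + cinner y z"
    and cinner_scaleC_left: "cinner (c *\<^sub>C x) y = c * cinner x y"
    and Re_cinner: "Re (cinner x y) = x \<bullet> y"

lemma norm_eq_sqrt_cinner: "norm x = sqrt (Re (cinner x x))"
  for x :: "'h::complex_hilbert_space"
  by (simp add: Re_cinner norm_eq_sqrt_inner)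

instantiation complex :: complex_hilbert_space
begin

definition scaleC_complex :: "complex \<Rightarrow> complex \<Rightarrow> complex"
  where "scaleC_complex c x = c * x"

definition cinner_complex :: "complex \<Rightarrow> complex \<Rightarrow> complex"
  where "cinner_complex x y = x * cnj y"

instance
  by standard
    (simp_all add: scaleC_complex_def cinner_complex_def algebra_simps inner_complex_def
      scaleR_conv_of_real)

end


section \<open>Unbounded operators\<close>

text \<open>
  An operator in \<open>H\<close> is a partial map \<open>'h \<rightharpoonup> 'h\<close>. Its domain is \<^const>\<open>dom\<close>; the relation
  \<open>S \<subseteq>\<^sub>m T\<close> says that \<open>T\<close> extends \<open>S\<close>; and the composition \<open>S \<circ>\<^sub>m T\<close> is defined exactly at those
  \<open>x \<in> dom T\<close> with \<open>T x \<in> dom S\<close>, so it is the operator product with its natural domain.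
  Equality of partial maps includes equality of domains.
\<close>

definition linear_operator :: "('h::complex_hilbert_space \<rightharpoonup> 'h) \<Rightarrow> bool" where
  "linear_operator T \<longleftrightarrow>
     0 \<in> dom T \<and>
     (\<forall>x\<in>dom T. \<forall>y\<in>dom T. x + y \<in> dom T \<and> the (T (x + y)) = the (T x) + the (T y)) \<and>
     (\<forall>c. \<forall>x\<in>dom T. c *\<^sub>C x \<in> dom T \<and> the (T (c *\<^sub>C x)) = c *\<^sub>C the (T x))"

definition densely_defined :: "('h::complex_hilbert_space \<rightharpoonup> 'h) \<Rightarrow> bool" where
  "densely_defined T \<longleftrightarrow> closure (dom T) = UNIV"

definition closed_operator :: "('h::complex_hilbert_space \<rightharpoonup> 'h) \<Rightarrow> bool" where
  "closed_operator T \<longleftrightarrow> closed (Map.graph T)"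

definition closed_extension ::
    "('h::complex_hilbert_space \<rightharpoonup> 'h) \<Rightarrow> ('h \<rightharpoonup> 'h) \<Rightarrow> bool" where
  "closed_extension T S \<longleftrightarrow> linear_operator S \<and> closed_operator S \<and> T \<subseteq>\<^sub>m S"

definition closable :: "('h::complex_hilbert_space \<rightharpoonup> 'h) \<Rightarrow> bool" where
  "closable T \<longleftrightarrow> (\<exists>S. closed_extension T S)"

definition op_closure :: "('h::complex_hilbert_space \<rightharpoonup> 'h) \<Rightarrow> ('h \<rightharpoonup> 'h)" where
  "op_closure T =
     (THE S. closed_extension T S \<and> (\<forall>R. closed_extension T R \<longrightarrow> S \<subseteq>\<^sub>m R))"

definition adjoint_at :: "('h::complex_hilbert_space \<rightharpoonup> 'h) \<Rightarrow> 'h \<Rightarrow> 'h \<Rightarrow> bool" where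
  "adjoint_at T y z \<longleftrightarrow> (\<forall>x\<in>dom T. cinner (the (T x)) y = cinner x z)"

text \<open>Meaningful for densely defined \<open>T\<close>, where the vector \<open>z\<close> below is unique.\<close>

definition op_adjoint :: "('h::complex_hilbert_space \<rightharpoonup> 'h) \<Rightarrow> ('h \<rightharpoonup> 'h)" where
  "op_adjoint T = (\<lambda>y. if \<exists>z. adjoint_at T y z then Some (THE z. adjoint_at T y z) else None)"

definition normal_operator :: "('h::complex_hilbert_space \<rightharpoonup> 'h) \<Rightarrow> bool" where
  "normal_operator T \<longleftrightarrow>
     linear_operator T \<and> densely_defined T \<and> closed_operator T \<and>
     T \<circ>\<^sub>m op_adjoint T = op_adjoint T \<circ>\<^sub>m T"

definition op_add ::
    "('h::complex_hilbert_space \<rightharpoonup> 'h) \<Rightarrow> ('h \<rightharpoonup> 'h) \<Rightarrow> ('h \<rightharpoonup> 'h)" where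
  "op_add S T =
     (\<lambda>x. if x \<in> dom S \<inter> dom T then Some (the (S x) + the (T x)) else None)"

definition op_scale :: "complex \<Rightarrow> ('h::complex_hilbert_space \<rightharpoonup> 'h) \<Rightarrow> ('h \<rightharpoonup> 'h)" where
  "op_scale c T = (\<lambda>x. map_option (scaleC c) (T x))"

text \<open>The identity operator on all of \<open>H\<close> is \<^const>\<open>Some\<close>.\<close>

primrec op_power :: "('h::complex_hilbert_space \<rightharpoonup> 'h) \<Rightarrow> nat \<Rightarrow> ('h \<rightharpoonup> 'h)" where
  "op_power T 0 = Some"
| "op_power T (Suc n) = T \<circ>\<^sub>m op_power T n"

primrec op_sum :: "(nat \<Rightarrow> 'h::complex_hilbert_space \<rightharpoonup> 'h) \<Rightarrow> nat \<Rightarrow> ('h \<rightharpoonup> 'h)" where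
  "op_sum F 0 = F 0"
| "op_sum F (Suc n) = op_add (op_sum F n) (F (Suc n))"

text \<open>\<open>p(T) = c\<^sub>0 I + c\<^sub>1 T + \<dots> + c\<^sub>n T\<^sup>n\<close> with \<open>n = degree p\<close>; its domain is that of \<open>T\<^sup>n\<close>.\<close>

definition op_poly :: "complex poly \<Rightarrow> ('h::complex_hilbert_space \<rightharpoonup> 'h) \<Rightarrow> ('h \<rightharpoonup> 'h)" where
  "op_poly p T = op_sum (\<lambda>k. op_scale (coeff p k) (op_power T k)) (degree p)"

text \<open>The elements of \<open>B(H)\<close>, as total functions.\<close>

definition bounded_clinear :: "('h::complex_hilbert_space \<Rightarrow> 'h) \<Rightarrow> bool" where
  "bounded_clinear B \<longleftrightarrow> bounded_linear B \<and> (\<forall>c x. B (c *\<^sub>C x) = c *\<^sub>C B x)"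

definition boundedly_invertible :: "('h::complex_hilbert_space \<rightharpoonup> 'h) \<Rightarrow> bool" where
  "boundedly_invertible S \<longleftrightarrow>
     bij_betw (\<lambda>x. the (S x)) (dom S) UNIV \<and>
     bounded_clinear (inv_into (dom S) (\<lambda>x. the (S x)))"

definition resolvent_set :: "('h::complex_hilbert_space \<rightharpoonup> 'h) \<Rightarrow> complex set" where
  "resolvent_set T =
     {\<mu>. boundedly_invertible (op_add (op_scale \<mu> Some) (op_scale (- 1) T))}"

definition op_spectrum :: "('h::complex_hilbert_space \<rightharpoonup> 'h) \<Rightarrow> complex set" where
  "op_spectrum T = - resolvent_set T"


section \<open>Well-definedness of closure and adjoint\<close>

lemma graph_le_iff: "Map.graph S \<subseteq> Map.graph T \<longleftrightarrow> S \<subseteq>\<^sub>m T"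
  by (auto simp: Map.graph_def map_le_def dom_def)

lemma linear_operator_Some_iff:
  "linear_operator T \<longleftrightarrow>
     T 0 = Some 0 \<and>
     (\<forall>x y u v. T x = Some u \<longrightarrow> T y = Some v \<longrightarrow> T (x + y) = Some (u + v)) \<and>
     (\<forall>c x u. T x = Some u \<longrightarrow> T (c *\<^sub>C x) = Some (c *\<^sub>C u))" (is "_ \<longleftrightarrow> ?R")
proof
  assume l: "linear_operator T"
  have add: "T (x + y) = Some (u + v)" if "T x = Some u" "T y = Some v" for x y u v
  proof -
    have "x + y \<in> dom T \<and> the (T (x + y)) = the (T x) + the (T y)"
      using l that unfolding linear_operator_def by (meson domI)
    with that show ?thesis by auto
  qed
  have scale: "T (c *\<^sub>C x) = Some (c *\<^sub>C u)" if "T x = Some u" for c x u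
  proof -
    have "c *\<^sub>C x \<in> dom T \<and> the (T (c *\<^sub>C x)) = c *\<^sub>C the (T x)"
      using l that unfolding linear_operator_def by (meson domI)
    with that show ?thesis by auto
  qed
  obtain u where u: "T 0 = Some u" using l unfolding linear_operator_def by blast
  with add[OF u u] have "T 0 = Some 0" by simp
  with add scale show ?R by blast
next
  assume R: ?R
  have "x + y \<in> dom T \<and> the (T (x + y)) = the (T x) + the (T y)"
    if "x \<in> dom T" "y \<in> dom T" for x y
  proof -
    from that obtain u v where uv: "T x = Some u" "T y = Some v" by blast
    then have "T (x + y) = Some (u + v)" using R by blast
    with uv show ?thesis by auto
  qed
  moreover have "c *\<^sub>C x \<in> dom T \<and> the (T (c *\<^sub>C x)) = c *\<^sub>C the (T x)"
    if "x \<in> dom T" for c x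
  proof -
    from that obtain u where u: "T x = Some u" by blast
    then have "T (c *\<^sub>C x) = Some (c *\<^sub>C u)" using R by blast
    with u show ?thesis by auto
  qed
  moreover have "0 \<in> dom T" using R by blast
  ultimately show "linear_operator T" unfolding linear_operator_def by blast
qed

lemma closed_extension_Int:
  fixes T :: "'h::complex_hilbert_space \<rightharpoonup> 'h"
  assumes "closable T"
  obtains S where "closed_extension T S" "\<And>R. closed_extension T R \<Longrightarrow> S \<subseteq>\<^sub>m R"
proof -
  obtain R0 where R0: "closed_extension T R0" using assms by (auto simp: closable_def)
  define S where "S = (\<lambda>x. if \<forall>R. closed_extension T R \<longrightarrow> R x = R0 x then R0 x else None)"
  have S_iff: "S x = Some y \<longleftrightarrow> (\<forall>R. closed_extension T R \<longrightarrow> R x = Some y)" for x y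
    using R0 unfolding S_def by (metis option.distinct(1))
  have graph: "Map.graph S = (\<Inter>R\<in>{R. closed_extension T R}. Map.graph R)"
    by (rule set_eqI) (simp add: Map.graph_def S_iff split_paired_all)
  have lin: "linear_operator R" if "closed_extension T R" for R
    using that by (simp add: closed_extension_def)
  have "S 0 = Some 0"
    unfolding S_iff using lin by (simp add: linear_operator_Some_iff)
  moreover have "S (x + y) = Some (u + v)" if "S x = Some u" "S y = Some v" for x y u v
    using that lin unfolding S_iff linear_operator_Some_iff by simp
  moreover have "S (c *\<^sub>C x) = Some (c *\<^sub>C u)" if "S x = Some u" for c x u
    using that lin unfolding S_iff linear_operator_Some_iff by simp
  ultimately have "linear_operator S"
    unfolding linear_operator_Some_iff by simp
  moreover have "closed_operator S"
    unfolding closed_operator_def graph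
    by (intro closed_INT) (auto simp: closed_extension_def closed_operator_def)
  moreover have "T \<subseteq>\<^sub>m S"
    unfolding graph_le_iff[symmetric] graph
    by (rule INT_greatest) (simp add: closed_extension_def graph_le_iff)
  ultimately have "closed_extension T S" by (simp add: closed_extension_def)
  moreover have "S \<subseteq>\<^sub>m R" if "closed_extension T R" for R
    unfolding graph_le_iff[symmetric] graph by (rule INT_lower) (simp add: that)
  ultimately show thesis by (rule that)
qed

lemma op_closure:
  fixes T :: "'h::complex_hilbert_space \<rightharpoonup> 'h"
  assumes "closable T"
  shows "closed_extension T (op_closure T)"
    and "closed_extension T R \<Longrightarrow> op_closure T \<subseteq>\<^sub>m R"
proof -
  let ?P = "\<lambda>S. closed_extension T S \<and> (\<forall>R. closed_extension T R \<longrightarrow> S \<subseteq>\<^sub>m R)"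
  obtain S where S: "?P S" using closed_extension_Int[OF assms] by blast
  have "?P (op_closure T)"
    unfolding op_closure_def by (rule theI[of ?P, OF S]) (use S map_le_antisym in blast)
  then show "closed_extension T (op_closure T)"
    and "closed_extension T R \<Longrightarrow> op_closure T \<subseteq>\<^sub>m R" by blast+
qed

lemma op_adjoint_eq_Some_iff:
  fixes T :: "'h::complex_hilbert_space \<rightharpoonup> 'h"
  assumes "densely_defined T"
  shows "op_adjoint T y = Some z \<longleftrightarrow> adjoint_at T y z"
proof -
  have uniq: "z = w" if "adjoint_at T y z" "adjoint_at T y w" for z w
  proof -
    have "x \<bullet> (z - w) = 0" if "x \<in> dom T" for x
    proof -
      have "cinner x z = cinner x w"
        using \<open>adjoint_at T y z\<close> \<open>adjoint_at T y w\<close> that unfolding adjoint_at_def by metis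
      then show ?thesis by (metis Re_cinner inner_diff_right right_minus_eq)
    qed
    then have "dom T \<subseteq> {x. x \<bullet> (z - w) = 0}" by auto
    moreover have "closed {x. x \<bullet> (z - w) = 0}"
      by (intro closed_Collect_eq continuous_intros)
    ultimately have "closure (dom T) \<subseteq> {x. x \<bullet> (z - w) = 0}"
      by (rule closure_minimal)
    then have "(z - w) \<bullet> (z - w) = 0" using assms unfolding densely_defined_def by blast
    then show ?thesis by simp
  qed
  show ?thesis
  proof
    assume *: "op_adjoint T y = Some z"
    then have "\<exists>z. adjoint_at T y z" and "z = (THE z. adjoint_at T y z)"
      by (auto simp: op_adjoint_def split: if_splits)
    then show "adjoint_at T y z" using theI[of "adjoint_at T y"] uniq by metis
  next
    assume *: "adjoint_at T y z"
    then have "(THE z. adjoint_at T y z) = z" using uniq by (intro the_equality)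
    then show "op_adjoint T y = Some z" using * by (auto simp: op_adjoint_def)
  qed
qed

end

theory Submission
  imports Defs "HOL-Computational_Algebra.Fundamental_Theorem_Algebra"
begin

text \<open>
  The operator \<open>A\<close> need not be closed (an everywhere defined discontinuous involution has
  \<open>A\<^sup>2 = 1\<close>), so the resolvent \<open>R = (A - \<nu>)\<^sup>-\<^sup>1\<close> at a root \<open>\<nu>\<close> of \<open>q = \<mu> - p\<close> is an everywhere
  defined linear map that may be discontinuous, and the classical theorem of Fuglede does not apply
  to it. It commutes with \<open>N\<close>, and with \<open>M\<close>, the closure of \<open>N\<close>, because the injective bounded
  operator \<open>B = q(A)\<^sup>-\<^sup>1\<close> does and maps into the domain of \<open>N\<close>. A version of Fuglede's theorem
  without continuity holds: since the range of \<open>M\<^sup>* - cnj \<lambda>\<close> is contained in that of \<open>M - \<lambda>\<close>, every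
  value of \<open>R M\<^sup>* - M\<^sup>* R\<close> lies in the range of \<open>M - \<lambda>\<close> for all \<open>\<lambda>\<close>, and for normal \<open>M\<close> the
  intersection of these ranges is 0. Hence \<open>R M\<^sup>* \<subseteq> M\<^sup>* R\<close>, which is the claim for \<open>A = \<nu> + R\<^sup>-\<^sup>1\<close>.
\<close>

section \<open>Orthogonal decomposition in Hilbert spaces\<close>

text \<open>Proofs of Fuglede's theorem for bounded \<open>R\<close> pass to limits on the side of
  \<open>R\<close>. Ranges of \<open>M - \<lambda>\<close> need no limit, because \<open>R\<close>
  maps each of them into itself by algebra alone; all analysis then falls on \<open>M\<close>. The
  inclusion of ranges rests on the equality of the norms of (M - \<lambda>) x and (M^* - cnj
  \<lambda>) x. The intersection of the ranges is treated after multiplying by S = (1 + M^*M)^-1: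
  then S, the real part X of MS and its imaginary part Y are commuting bounded self-adjoint
  operators, and X - \<alpha> S stands for the real part of M - \<lambda>. Cutting with projections
  onto kernels of Q - |Q| suffices, so no spectral measure is built. The bounded operators are
  studied over the real inner product, and multiplication by i becomes one more operator
  \<open>J\<close> that commutes with them. A positive degree of p supplies the root \<nu>: for
  constant p, p(A) is a multiple of the identity and its spectrum carries no information on
  A.\<close>

instance complex_hilbert_space \<subseteq> banach ..

text \<open>If \<open>g x = L x \<bullet> w\<close> held, \<open>\<phi> x\<close> would be the
  squared distance from \<open>L x\<close> to \<open>w\<close> minus the squared norm of
  \<open>w\<close>; so \<open>w\<close> is found as the limit of \<open>L\<close> along a minimizing
  sequence of \<open>\<phi>\<close>. With \<open>L\<close> the identity this gives orthogonal
  projections, with \<open>L\<close> a shifted adjoint it gives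
  \<open>range_adjoint\<close>.\<close>

lemma riesz_dominated:
  fixes L :: "'b::real_vector \<Rightarrow> 'a::{real_inner,banach}" and g :: "'b \<Rightarrow> real"
  assumes D: "subspace D"
    and L_add: "\<And>x y. x \<in> D \<Longrightarrow> y \<in> D \<Longrightarrow> L (x + y) = L x + L y"
    and L_scale: "\<And>c x. x \<in> D \<Longrightarrow> L (c *\<^sub>R x) = c *\<^sub>R L x"
    and g_add: "\<And>x y. x \<in> D \<Longrightarrow> y \<in> D \<Longrightarrow> g (x + y) = g x + g y"
    and g_scale: "\<And>c x. x \<in> D \<Longrightarrow> g (c *\<^sub>R x) = c * g x"
    and bound: "\<And>x. x \<in> D \<Longrightarrow> \<bar>g x\<bar> \<le> K * norm (L x)"
  obtains w where "w \<in> closure (L ` D)" "\<And>x. x \<in> D \<Longrightarrow> g x = L x \<bullet> w"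
proof -
  define \<phi> where "\<phi> x = (norm (L x))\<^sup>2 - 2 * g x" for x
  define I where "I = Inf (\<phi> ` D)"
  have "0 \<in> D" using D by (rule subspace_0)
  have lower: "- K\<^sup>2 \<le> \<phi> x" if "x \<in> D" for x
  proof -
    have "g x \<le> K * norm (L x)" using bound[OF that] by simp
    moreover have "0 \<le> (norm (L x) - K)\<^sup>2" by simp
    ultimately show ?thesis unfolding \<phi>_def by (simp add: power2_diff algebra_simps)
  qed
  have I_le: "I \<le> \<phi> x" if "x \<in> D" for x
    unfolding I_def using that lower by (intro cInf_lower bdd_belowI[where m = "- K\<^sup>2"]) auto
  have "\<exists>x\<in>D. \<phi> x < I + 1 / Suc k" for k
  proof -
    have "Inf (\<phi> ` D) < I + 1 / Suc k" unfolding I_def by simp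
    then have "\<exists>r\<in>\<phi> ` D. r < I + 1 / Suc k"
      using \<open>0 \<in> D\<close> by (intro cInf_lessD) auto
    then show ?thesis by blast
  qed
  then obtain x where xD: "x k \<in> D" and x_less: "\<phi> (x k) < I + 1 / Suc k" for k
    by metis
  \<comment> \<open>Parallelogram law at the midpoint \<open>c\<close> of \<open>x i\<close> and
    \<open>x j\<close>, where \<open>\<phi>\<close> is at least \<open>I\<close>.\<close>
  have near: "(dist (L (x i)) (L (x j)))\<^sup>2 \<le> 2 / Suc i + 2 / Suc j" for i j
  proof -
    define c where "c = (1/2) *\<^sub>R (x i + x j)"
    have cD: "c \<in> D" unfolding c_def using D xD by (intro subspace_scale subspace_add)
    have Lc: "L c = (1/2) *\<^sub>R (L (x i) + L (x j))" and gc: "g c = (1/2) * (g (x i) + g (x j))"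
      unfolding c_def using D xD by (simp_all add: L_add L_scale g_add g_scale subspace_add)
    have "(dist (L (x i)) (L (x j)))\<^sup>2 = 2 * \<phi> (x i) + 2 * \<phi> (x j) - 4 * \<phi> c"
      unfolding \<phi>_def Lc gc dist_norm
      by (simp add: power2_norm_eq_inner algebra_simps inner_commute)
    then show ?thesis using I_le[OF cD] x_less[of i] x_less[of j] by simp
  qed
  have "Cauchy (\<lambda>k. L (x k))"
  proof (rule metric_CauchyI)
    fix e :: real assume e: "0 < e"
    obtain M where M: "4 / e\<^sup>2 < real M" using reals_Archimedean2 by blast
    have "dist (L (x i)) (L (x j)) < e" if "M \<le> i" "M \<le> j" for i j
    proof (rule power2_less_imp_less)
      have pos: "0 < 4 / e\<^sup>2" using e by simp
      have "2 / real (Suc k) < e\<^sup>2 / 2" if "M \<le> k" for k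
      proof -
        have "4 / e\<^sup>2 < real (Suc k)" using M that by linarith
        then show ?thesis using e by (simp add: field_simps)
      qed
      then show "(dist (L (x i)) (L (x j)))\<^sup>2 < e\<^sup>2"
        using near[of i j] that by (smt (verit) field_sum_of_halves)
    qed (use e in simp)
    then show "\<exists>M. \<forall>i\<ge>M. \<forall>j\<ge>M. dist (L (x i)) (L (x j)) < e" by blast
  qed
  then obtain w where w: "(\<lambda>k. L (x k)) \<longlonglongrightarrow> w" using Cauchy_convergent convergent_def by blast
  have lim_I: "(\<lambda>k. \<phi> (x k)) \<longlonglongrightarrow> I"
  proof (rule real_tendsto_sandwich[where f = "\<lambda>_. I" and h = "\<lambda>k. I + 1 / Suc k"])
    show "(\<lambda>k. I + 1 / real (Suc k)) \<longlonglongrightarrow> I"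
      using tendsto_add[OF tendsto_const lim_inverse_n', of I, THEN LIMSEQ_Suc] by simp
  qed (use I_le xD x_less[THEN less_imp_le] in \<open>auto intro!: always_eventually simp del: of_nat_Suc\<close>)
  have "g y = L y \<bullet> w" if y: "y \<in> D" for y
  proof -
    have quad: "0 \<le> 2 * t * (w \<bullet> L y - g y) + t\<^sup>2 * (norm (L y))\<^sup>2" for t
    proof -
      have "I \<le> \<phi> (x k) + 2 * t * (L (x k) \<bullet> L y - g y) + t\<^sup>2 * (norm (L y))\<^sup>2" for k
      proof -
        have "x k + t *\<^sub>R y \<in> D" using D xD y by (intro subspace_scale subspace_add)
        moreover have "\<phi> (x k + t *\<^sub>R y)
            = \<phi> (x k) + 2 * t * (L (x k) \<bullet> L y - g y) + t\<^sup>2 * (norm (L y))\<^sup>2"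
          unfolding \<phi>_def power2_norm_eq_inner power2_eq_square[of t] using D xD y
          by (simp add: L_add L_scale g_add g_scale subspace_scale algebra_simps inner_commute)
        ultimately show ?thesis using I_le by metis
      qed
      moreover have "(\<lambda>k. \<phi> (x k) + 2 * t * (L (x k) \<bullet> L y - g y) + t\<^sup>2 * (norm (L y))\<^sup>2)
          \<longlonglongrightarrow> I + 2 * t * (w \<bullet> L y - g y) + t\<^sup>2 * (norm (L y))\<^sup>2"
        by (intro tendsto_intros lim_I w)
      ultimately have "I \<le> I + 2 * t * (w \<bullet> L y - g y) + t\<^sup>2 * (norm (L y))\<^sup>2"
        by (intro LIMSEQ_le_const) auto
      then show ?thesis by simp
    qed
    \<comment> \<open>A nearly optimal \<open>t = - d / s\<close> is inserted into the quadratic;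
      the summand 1 in \<open>s\<close> keeps the division legitimate when
      \<open>L y = 0\<close>.\<close>
    define d where "d = w \<bullet> L y - g y"
    define s where "s = (norm (L y))\<^sup>2 + 1"
    have s: "s > 0" unfolding s_def by (simp add: add_nonneg_pos)
    have "0 \<le> 2 * (- d / s) * d + (- d / s)\<^sup>2 * (s - 1)"
      using quad[of "- d / s"] unfolding d_def s_def by simp
    also have "\<dots> = - (d\<^sup>2 / s) - d\<^sup>2 / s\<^sup>2"
      using s by (simp add: field_simps power2_eq_square)
    finally have "d\<^sup>2 / s + d\<^sup>2 / s\<^sup>2 \<le> 0" by simp
    moreover have "0 \<le> d\<^sup>2 / s" "0 \<le> d\<^sup>2 / s\<^sup>2" using s by auto
    ultimately have "d\<^sup>2 / s = 0" by linarith
    then have "d = 0" using s by simp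
    then show ?thesis by (simp add: d_def inner_commute)
  qed
  moreover have "w \<in> closure (L ` D)"
    unfolding closure_sequential using w xD by (intro exI[of _ "\<lambda>k. L (x k)"]) auto
  ultimately show thesis by (rule that[rotated])
qed

lemma orthogonal_decomposition:
  fixes V :: "'a::{real_inner,banach} set"
  assumes "subspace V"
  obtains w where "w \<in> closure V" "\<And>v. v \<in> closure V \<Longrightarrow> v \<bullet> (x - w) = 0"
proof -
  obtain w where w: "w \<in> closure ((\<lambda>v. v) ` V)" and eq: "\<And>v. v \<in> V \<Longrightarrow> v \<bullet> x = v \<bullet> w"
    by (rule riesz_dominated[OF assms, where L = "\<lambda>v. v" and g = "\<lambda>v. v \<bullet> x" and K = "norm x"])
      (auto simp: inner_add_left Cauchy_Schwarz_ineq2 mult.commute)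
  have "V \<subseteq> {v. v \<bullet> (x - w) = 0}" using eq by (auto simp: inner_diff_right)
  then have "closure V \<subseteq> {v. v \<bullet> (x - w) = 0}"
    by (rule closure_minimal) (intro closed_Collect_eq continuous_intros)
  then show thesis using w by (intro that) auto
qed

text \<open>The residual of the projection of \<open>x\<close> is orthogonal to \<open>V\<close>, so
  the assumption applied to it makes it orthogonal to itself.\<close>

lemma in_closure_if_orthogonal:
  fixes V :: "'a::{real_inner,banach} set"
  assumes V: "subspace V" and *: "\<And>y. (\<And>v. v \<in> V \<Longrightarrow> v \<bullet> y = 0) \<Longrightarrow> x \<bullet> y = 0"
  shows "x \<in> closure V"
proof -
  obtain w where w: "w \<in> closure V" and orth: "\<And>v. v \<in> closure V \<Longrightarrow> v \<bullet> (x - w) = 0"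
    using orthogonal_decomposition[OF V] by blast
  have "x \<bullet> (x - w) = 0" by (rule *) (use orth closure_subset in blast)
  moreover have "w \<bullet> (x - w) = 0" using orth w .
  ultimately have "(x - w) \<bullet> (x - w) = 0" by (simp add: inner_diff_left)
  then show ?thesis using w by simp
qed

section \<open>Square roots and spectral projections of self-adjoint operators\<close>

definition selfadj :: "('a::real_inner \<Rightarrow>\<^sub>L 'a) \<Rightarrow> bool" where
  "selfadj Q \<longleftrightarrow> (\<forall>x y. Q x \<bullet> y = x \<bullet> Q y)"

text \<open>To commute with an orthogonal projection, an operator has to map both the range and its
  orthogonal complement into themselves; the second is obtained from the adjoint
  \<open>C'\<close>.\<close>

definition adjointable :: "('a::real_inner \<Rightarrow>\<^sub>L 'a) \<Rightarrow> bool" where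
  "adjointable C \<longleftrightarrow> (\<exists>C'. \<forall>x y. C x \<bullet> y = x \<bullet> blinfun_apply C' y)"

definition commute :: "('a::real_normed_vector \<Rightarrow>\<^sub>L 'a) \<Rightarrow> ('a \<Rightarrow>\<^sub>L 'a) \<Rightarrow> bool" where
  "commute S T \<longleftrightarrow> (\<forall>x. S (T x) = T (S x))"

lemma selfadjD: "selfadj Q \<Longrightarrow> Q x \<bullet> y = x \<bullet> Q y"
  by (simp add: selfadj_def)

lemma selfadj_adjointable: "selfadj Q \<Longrightarrow> adjointable Q"
  unfolding selfadj_def adjointable_def by blast

lemma selfadj_blinfun_intros [intro]:
  "selfadj (0 :: 'a::real_inner \<Rightarrow>\<^sub>L 'a)" "selfadj (id_blinfun :: 'a \<Rightarrow>\<^sub>L 'a)"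
  "selfadj P \<Longrightarrow> selfadj Q \<Longrightarrow> selfadj (P + Q)"
  "selfadj P \<Longrightarrow> selfadj Q \<Longrightarrow> selfadj (P - Q)"
  "selfadj P \<Longrightarrow> selfadj (r *\<^sub>R P)"
  "selfadj P \<Longrightarrow> selfadj Q \<Longrightarrow> commute P Q \<Longrightarrow> selfadj (P o\<^sub>L Q)"
  by (simp_all add: selfadj_def commute_def blinfun.bilinear_simps inner_simps)

lemma commute_sym: "commute S T \<Longrightarrow> commute T S"
  by (simp add: commute_def)

lemma commute_intros [intro]:
  "commute C 0" "commute C id_blinfun" "commute C C"
  "commute C P \<Longrightarrow> commute C Q \<Longrightarrow> commute C (P + Q)"
  "commute C P \<Longrightarrow> commute C Q \<Longrightarrow> commute C (P - Q)"
  "commute C P \<Longrightarrow> commute C (r *\<^sub>R P)"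
  "commute C P \<Longrightarrow> commute C Q \<Longrightarrow> commute C (P o\<^sub>L Q)"
  by (simp_all add: commute_def blinfun.bilinear_simps)

text \<open>The iteration \<open>Z \<mapsto> (B + Z\<^sup>2)/2\<close> is dominated in norm by the same iteration on the scalar 1,
  which increases to 1; its fixed point \<open>Z\<close> satisfies \<open>(1 - Z)\<^sup>2 = 1 - B\<close>.\<close>

lemma sqrt_iteration:
  fixes B :: "'a::{real_inner,banach} \<Rightarrow>\<^sub>L 'a"
  assumes B: "norm B \<le> 1"
  obtains Z where "norm Z \<le> 1" "2 *\<^sub>R Z = B + (Z o\<^sub>L Z)"
    "\<And>C. commute C B \<Longrightarrow> commute C Z"
    "selfadj B \<Longrightarrow> selfadj Z"
proof -
  define Z where "Z = rec_nat (0 :: 'a \<Rightarrow>\<^sub>L 'a) (\<lambda>_ T. (1/2) *\<^sub>R (B + (T o\<^sub>L T)))"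
  define r where "r = rec_nat (0 :: real) (\<lambda>_ t. (1/2) * (1 + t * t))"
  have Z_0 [simp]: "Z 0 = 0" and Z_Suc: "Z (Suc k) = (1/2) *\<^sub>R (B + (Z k o\<^sub>L Z k))" for k
    by (simp_all add: Z_def)
  have r_0 [simp]: "r 0 = 0" and r_Suc: "r (Suc k) = (1/2) * (1 + r k * r k)" for k
    by (simp_all add: r_def)
  have commute_Z: "commute C (Z k)" if "commute C B" for C k
    by (induction k) (use that in \<open>auto simp: Z_Suc\<close>)
  \<comment> \<open>Every iterate commutes with whatever commutes with \<open>B\<close>: first with
    \<open>B\<close> itself, and then with all other iterates.\<close>
  have comm: "commute (Z j) (Z k)" for j k
    by (rule commute_Z[OF commute_sym[OF commute_Z[OF commute_intros(3)]]])
  have r: "0 \<le> r k \<and> r k \<le> 1" for k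
  proof (induction k)
    case (Suc k)
    then have "r k * r k \<le> 1" using mult_le_one by blast
    then show ?case using Suc by (simp add: r_Suc)
  qed simp
  have norm_Z: "norm (Z k) \<le> r k" for k
  proof (induction k)
    case (Suc k)
    have "norm (Z k o\<^sub>L Z k) \<le> norm (Z k) * norm (Z k)" by (rule norm_blinfun_compose)
    also have "\<dots> \<le> r k * r k" using Suc r by (intro mult_mono) auto
    finally have "norm (B + (Z k o\<^sub>L Z k)) \<le> 1 + r k * r k"
      using B norm_triangle_ineq[of B "Z k o\<^sub>L Z k"] by linarith
    then show ?case by (simp add: Z_Suc r_Suc)
  qed simp
  \<comment> \<open>Commuting iterates allow a difference of squares to be factored as difference
    times sum; the scalar recursion for \<open>r\<close> factors in the same way.\<close>
  have step: "norm (Z (Suc k) - Z k) \<le> r (Suc k) - r k" for k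
  proof (induction k)
    case 0
    show ?case using B by (simp add: Z_Suc r_Suc)
  next
    case (Suc k)
    have "Z (Suc (Suc k)) - Z (Suc k)
        = (1/2) *\<^sub>R ((Z (Suc k) - Z k) o\<^sub>L (Z (Suc k) + Z k))"
    proof (rule blinfun_eqI)
      fix x
      have "Z (Suc k) (Z k x) = Z k (Z (Suc k) x)" using comm by (simp add: commute_def)
      then show "(Z (Suc (Suc k)) - Z (Suc k)) x
          = ((1/2) *\<^sub>R ((Z (Suc k) - Z k) o\<^sub>L (Z (Suc k) + Z k))) x"
        using arg_cong[OF Z_Suc[of k], of "\<lambda>T. blinfun_apply T x"]
        by (simp add: Z_Suc[of "Suc k"] blinfun.bilinear_simps algebra_simps)
    qed
    then have "norm (Z (Suc (Suc k)) - Z (Suc k))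
        = (1/2) * norm ((Z (Suc k) - Z k) o\<^sub>L (Z (Suc k) + Z k))" by simp
    also have "\<dots> \<le> (1/2) * (norm (Z (Suc k) - Z k) * norm (Z (Suc k) + Z k))"
      by (simp add: norm_blinfun_compose)
    also have "\<dots> \<le> (1/2) * ((r (Suc k) - r k) * (r (Suc k) + r k))"
    proof -
      have "norm (Z (Suc k) + Z k) \<le> r (Suc k) + r k"
        using norm_triangle_ineq[of "Z (Suc k)" "Z k"] norm_Z[of k] norm_Z[of "Suc k"] by linarith
      moreover have "0 \<le> r (Suc k) - r k" using Suc norm_ge_zero order_trans by blast
      ultimately show ?thesis using Suc by (intro mult_left_mono mult_mono) simp_all
    qed
    also have "\<dots> = r (Suc (Suc k)) - r (Suc k)"
      by (simp add: r_Suc[of "Suc k"]) (simp add: r_Suc algebra_simps)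
    finally show ?case .
  qed
  have r_mono: "incseq r"
    by (rule incseq_SucI) (use order_trans[OF norm_ge_zero step] in simp)
  have dist_Z: "norm (Z (k + d) - Z k) \<le> r (k + d) - r k" for k d
  proof (induction d)
    case (Suc d)
    have "norm (Z (k + Suc d) - Z k)
        \<le> norm (Z (Suc (k + d)) - Z (k + d)) + norm (Z (k + d) - Z k)"
      using norm_triangle_ineq[of "Z (Suc (k + d)) - Z (k + d)" "Z (k + d) - Z k"] by simp
    then show ?case using step[of "k + d"] Suc by simp
  qed simp
  obtain l where "r \<longlonglongrightarrow> l" using incseq_convergent[OF r_mono, of 1] r by blast
  then have "convergent r" by (rule convergentI)
  then have "Cauchy r" by (rule convergent_Cauchy)
  have "Cauchy Z"
  proof (rule metric_CauchyI)
    fix e :: real assume "0 < e"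
    then obtain M where M: "\<And>i j. M \<le> i \<Longrightarrow> M \<le> j \<Longrightarrow> dist (r i) (r j) < e"
      using metric_CauchyD[OF \<open>Cauchy r\<close>] by blast
    have "dist (Z i) (Z j) < e" if "M \<le> i" "i \<le> j" for i j
      using dist_Z[of i "j - i"] M[of i j] that by (simp add: dist_norm norm_minus_commute abs_if split: if_splits)
    then show "\<exists>M. \<forall>i\<ge>M. \<forall>j\<ge>M. dist (Z i) (Z j) < e"
      by (metis dist_commute linorder_le_cases)
  qed
  then obtain Y where Y: "Z \<longlonglongrightarrow> Y" using Cauchy_convergent convergent_def by blast
  show thesis
  proof
    show "norm Y \<le> 1"
      by (rule LIMSEQ_le_const2[OF tendsto_norm[OF Y]]) (use norm_Z r order_trans in blast)
    have "(\<lambda>k. 2 *\<^sub>R Z (Suc k)) \<longlonglongrightarrow> 2 *\<^sub>R Y"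
      by (intro tendsto_intros LIMSEQ_Suc Y)
    moreover have "(\<lambda>k. 2 *\<^sub>R Z (Suc k)) \<longlonglongrightarrow> B + (Y o\<^sub>L Y)"
      unfolding Z_Suc
      by (simp, intro tendsto_intros bounded_bilinear.tendsto[OF bounded_bilinear_blinfun_compose] Y)
    ultimately show "2 *\<^sub>R Y = B + (Y o\<^sub>L Y)" by (rule LIMSEQ_unique)
    show "commute C Y" if "commute C B" for C
    proof -
      have "closed {T. commute C T}"
        unfolding commute_def by (intro closed_Collect_all closed_Collect_eq continuous_intros)
      then show ?thesis using closed_sequentially[OF _ _ Y] commute_Z[OF that] by blast
    qed
    show "selfadj Y" if "selfadj B"
    proof -
      have "selfadj (Z k)" for k
        by (induction k) (use that in \<open>auto simp: Z_Suc\<close>)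
      moreover have "closed {T :: 'a \<Rightarrow>\<^sub>L 'a. selfadj T}"
        unfolding selfadj_def by (intro closed_Collect_all closed_Collect_eq continuous_intros)
      ultimately show ?thesis using closed_sequentially[OF _ _ Y] by blast
    qed
  qed
qed

text \<open>\<open>Y\<close> is the absolute value of \<open>Q\<close>. For the contraction
  \<open>T = Q / s\<close> the iteration with \<open>B = 1 - T^2\<close> yields
  \<open>(1 - Z)^2 = T^2\<close>, and \<open>norm Z \<le> 1\<close> makes \<open>1 - Z\<close>
  positive.\<close>

lemma selfadj_abs:
  fixes Q :: "'a::{real_inner,banach} \<Rightarrow>\<^sub>L 'a"
  assumes Q: "selfadj Q"
  obtains Y where "selfadj Y" "\<And>x. Y (Y x) = Q (Q x)" "\<And>x. 0 \<le> Y x \<bullet> x"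
    "\<And>C. commute C Q \<Longrightarrow> commute C Y"
proof -
  define s where "s = norm Q + 1"
  have s: "s > 0" unfolding s_def by (simp add: add_nonneg_pos)
  define T where "T = (1/s) *\<^sub>R Q"
  have T: "selfadj T" unfolding T_def using Q by blast
  have norm_T: "norm (T x) \<le> norm x" for x
  proof -
    have "norm (T x) \<le> norm T * norm x" by (rule norm_blinfun)
    also have "norm T \<le> 1" unfolding T_def using s by (simp add: s_def)
    finally show ?thesis by (simp add: mult_right_mono)
  qed
  define B where "B = id_blinfun - (T o\<^sub>L T)"
  \<comment> \<open>The triangle inequality would only give 2. Symmetry of \<open>T\<close> turns
    the cross term into minus twice the squared norm of \<open>T x\<close>, which absorbs the last
    term.\<close>
  have "norm B \<le> 1"
  proof (rule norm_blinfun_bound)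
    fix x
    have "(norm (B x))\<^sup>2 = (norm x)\<^sup>2 - 2 * (norm (T x))\<^sup>2 + (norm (T (T x)))\<^sup>2"
      unfolding B_def using selfadjD[OF T, of x "T x"] selfadjD[OF T, of "T x" x]
      by (simp add: blinfun.bilinear_simps power2_norm_eq_inner inner_diff inner_commute)
    also have "\<dots> \<le> (norm x)\<^sup>2"
      using power_mono[OF norm_T[of "T x"] norm_ge_zero, of 2] zero_le_power2[of "norm (T x)"]
      by linarith
    finally show "norm (B x) \<le> 1 * norm x" using power2_le_imp_le[OF _ norm_ge_zero] by simp
  qed simp
  then obtain Z where Z: "norm Z \<le> 1" "2 *\<^sub>R Z = B + (Z o\<^sub>L Z)"
    and comm_Z: "\<And>C. commute C B \<Longrightarrow> commute C Z"
    and "selfadj B \<Longrightarrow> selfadj Z"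
    by (rule sqrt_iteration) blast
  moreover have "selfadj B" unfolding B_def using T by blast
  ultimately have "selfadj Z" by blast
  define Y where "Y = s *\<^sub>R (id_blinfun - Z)"
  show thesis
  proof
    show "selfadj Y" unfolding Y_def using \<open>selfadj Z\<close> by blast
    show "Y (Y x) = Q (Q x)" for x
    proof -
      have "2 *\<^sub>R Z x = B x + Z (Z x)"
        using arg_cong[OF Z(2), of "\<lambda>T. blinfun_apply T x"] by (simp add: blinfun.bilinear_simps)
      then have "x - 2 *\<^sub>R Z x + Z (Z x) = T (T x)"
        unfolding B_def by (simp add: blinfun.bilinear_simps)
      moreover have "Q = s *\<^sub>R T" unfolding T_def using s by simp
      moreover have "Y (Y x) = s *\<^sub>R s *\<^sub>R (x - 2 *\<^sub>R Z x + Z (Z x))"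
        unfolding Y_def by (simp add: blinfun.bilinear_simps scaleR_2 algebra_simps)
      ultimately show ?thesis by (simp add: blinfun.bilinear_simps)
    qed
    show "0 \<le> Y x \<bullet> x" for x
    proof -
      have "Z x \<bullet> x \<le> norm (Z x) * norm x" by (rule norm_cauchy_schwarz)
      also have "\<dots> \<le> (1 * norm x) * norm x"
        using order_trans[OF norm_blinfun mult_right_mono[OF Z(1) norm_ge_zero]]
        by (rule mult_right_mono) simp
      finally have "Z x \<bullet> x \<le> x \<bullet> x" by (simp add: dot_square_norm power2_eq_square)
      then show ?thesis unfolding Y_def using s by (simp add: blinfun.bilinear_simps inner_diff_left)
    qed
    show "commute C Y" if "commute C Q" for C
      unfolding Y_def using that by (intro commute_intros comm_Z) (auto simp: B_def T_def)
  qed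
qed

text \<open>The last clause characterises \<open>P x\<close>; idempotence and commutation of
  \<open>P\<close> are later read off from it.\<close>

lemma orthogonal_projection:
  fixes K :: "'a::{real_inner,banach} set"
  assumes K: "subspace K" "closed K"
  obtains P :: "'a \<Rightarrow>\<^sub>L 'a" where "\<And>x. P x \<in> K" "\<And>x v. v \<in> K \<Longrightarrow> v \<bullet> (x - P x) = 0"
    "\<And>x w. w \<in> K \<Longrightarrow> (\<And>v. v \<in> K \<Longrightarrow> v \<bullet> (x - w) = 0) \<Longrightarrow> w = P x"
proof -
  have "\<exists>w. w \<in> K \<and> (\<forall>v\<in>K. v \<bullet> (x - w) = 0)" for x
    using orthogonal_decomposition[OF K(1), of x] K(2) by (metis closure_closed)
  then obtain p where p: "\<And>x. p x \<in> K" and orth: "\<And>x v. v \<in> K \<Longrightarrow> v \<bullet> (x - p x) = 0"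
    by metis
  have unique: "w = p x" if w: "w \<in> K" and *: "\<And>v. v \<in> K \<Longrightarrow> v \<bullet> (x - w) = 0" for w x
  proof -
    have "w - p x \<in> K" using K(1) w p by (rule subspace_diff)
    then have "(w - p x) \<bullet> (w - p x) = (w - p x) \<bullet> (x - p x) - (w - p x) \<bullet> (x - w)"
      by (simp add: inner_diff_right)
    also have "\<dots> = 0" using orth * \<open>w - p x \<in> K\<close> by simp
    finally show ?thesis by simp
  qed
  have "bounded_linear p"
  proof (rule bounded_linear_intro)
    show "p (x + y) = p x + p y" for x y
    proof (rule unique[symmetric])
      show "v \<bullet> (x + y - (p x + p y)) = 0" if "v \<in> K" for v
        using orth[OF that, of x] orth[OF that, of y] by (simp add: inner_simps)
    qed (intro subspace_add K p)
    show "p (r *\<^sub>R x) = r *\<^sub>R p x" for r x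
    proof (rule unique[symmetric])
      show "v \<bullet> (r *\<^sub>R x - r *\<^sub>R p x) = 0" if "v \<in> K" for v
        using orth[OF that, of x] by (simp add: inner_simps)
    qed (intro subspace_scale K p)
    show "norm (p x) \<le> norm x * 1" for x
    proof -
      have "p x \<bullet> p x = p x \<bullet> x" using orth[OF p, of x x] by (simp add: inner_diff_right)
      then have "norm (p x) * norm (p x) \<le> norm (p x) * norm x"
        using norm_cauchy_schwarz[of "p x" x] by (simp add: dot_square_norm power2_eq_square)
      then show ?thesis by (cases "p x = 0") simp_all
    qed
  qed
  then show thesis
    using p orth unique by (intro that[of "Blinfun p"]) (simp_all add: bounded_linear_Blinfun_apply)
qed

text \<open>\<open>P\<close> projects onto the kernel of \<open>Q - |Q|\<close>, where
  \<open>Q\<close> agrees with a positive operator. It is the spectral projection of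
  \<open>Q\<close> for the nonnegative half-line.\<close>

lemma spectral_cut:
  fixes Q :: "'a::{real_inner,banach} \<Rightarrow>\<^sub>L 'a"
  assumes Q: "selfadj Q"
  obtains P where "selfadj P" "\<And>x. P (P x) = P x"
    "\<And>C. adjointable C \<Longrightarrow> commute C Q \<Longrightarrow> commute C P"
    "\<And>x. 0 \<le> Q (P x) \<bullet> P x" "\<And>x. Q (x - P x) \<bullet> (x - P x) \<le> 0"
proof -
  obtain Y where Y: "selfadj Y" "\<And>x. Y (Y x) = Q (Q x)" "\<And>x. 0 \<le> Y x \<bullet> x"
    and comm_Y: "\<And>C. commute C Q \<Longrightarrow> commute C Y"
    using selfadj_abs[OF Q] by blast
  define K where "K = {x. Q x = Y x}"
  have K: "subspace K" "closed K"
  proof -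
    show "subspace K"
      unfolding K_def subspace_def by (simp add: blinfun.bilinear_simps)
    show "closed K" unfolding K_def by (intro closed_Collect_eq continuous_intros)
  qed
  obtain P :: "'a \<Rightarrow>\<^sub>L 'a" where PK: "\<And>x. P x \<in> K"
    and orth: "\<And>x v. v \<in> K \<Longrightarrow> v \<bullet> (x - P x) = 0"
    and P_unique: "\<And>x w. w \<in> K \<Longrightarrow> (\<And>v. v \<in> K \<Longrightarrow> v \<bullet> (x - w) = 0) \<Longrightarrow> w = P x"
    using orthogonal_projection[OF K] by blast
  have orth_eq: "v \<bullet> x = v \<bullet> P x" if "v \<in> K" for v x
    using orth[OF that, of x] by (simp add: inner_diff_right)
  have QY: "Q (Y x) = Y (Q x)" for x
    using comm_Y[of Q] by (auto simp: commute_def)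
  show thesis
  proof
    show "selfadj P"
      unfolding selfadj_def using orth_eq PK by (metis inner_commute)
    show "P (P x) = P x" for x
      by (rule P_unique[symmetric]) (simp_all add: PK)
    show "commute C P" if "adjointable C" and CQ: "commute C Q" for C
      unfolding commute_def
    proof
      fix x
      obtain C' :: "'a \<Rightarrow>\<^sub>L 'a" where adj: "\<And>x y. C x \<bullet> y = x \<bullet> C' y"
        using \<open>adjointable C\<close> unfolding adjointable_def by blast
      have CY: "commute C Y" using CQ by (rule comm_Y)
      \<comment> \<open>Invariance of \<open>K\<close> under the adjoint means invariance of the
        orthogonal complement of \<open>K\<close> under \<open>C\<close>.\<close>
      have inv: "C' v \<in> K" if "v \<in> K" for v
      proof -
        have "u \<bullet> Q (C' v) = u \<bullet> Y (C' v)" for u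
        proof -
          have "u \<bullet> Q (C' v) = C (Q u) \<bullet> v" by (simp add: adj selfadjD[OF Q])
          also have "\<dots> = C u \<bullet> Q v" using CQ by (simp add: commute_def selfadjD[OF Q])
          also have "\<dots> = C u \<bullet> Y v" using that by (simp add: K_def)
          also have "\<dots> = C (Y u) \<bullet> v" using CY by (simp add: commute_def selfadjD[OF Y(1)])
          also have "\<dots> = u \<bullet> Y (C' v)" by (simp add: adj selfadjD[OF Y(1)])
          finally show ?thesis .
        qed
        then have "Q (C' v) = Y (C' v)" using vector_eq_ldot[of "Q (C' v)" "Y (C' v)"] by simp
        then show ?thesis by (simp add: K_def)
      qed
      show "C (P x) = P (C x)"
      proof (rule P_unique)
        have "Q (C (P x)) = C (Q (P x))" "Y (C (P x)) = C (Y (P x))"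
          using CQ CY by (simp_all add: commute_def)
        then show "C (P x) \<in> K" using PK[of x] by (simp add: K_def)
        show "v \<bullet> (C x - C (P x)) = 0" if "v \<in> K" for v
        proof -
          have "v \<bullet> (C x - C (P x)) = C (x - P x) \<bullet> v"
            by (simp add: blinfun.bilinear_simps inner_commute)
          also have "\<dots> = C' v \<bullet> (x - P x)" unfolding adj by (rule inner_commute)
          finally show ?thesis using orth[OF inv[OF that]] by simp
        qed
      qed
    qed
    show "0 \<le> Q (P x) \<bullet> P x" for x
      using PK[of x] Y(3)[of "P x"] by (simp add: K_def)
    show "Q (x - P x) \<bullet> (x - P x) \<le> 0" for x
    proof -
      \<comment> \<open>\<open>(Y - Q)(Y + Q) = 0\<close>, so \<open>Y + Q\<close> maps into \<open>K\<close> and hence vanishes on its complement.\<close>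
      have in_K: "Q u + Y u \<in> K" for u
        unfolding K_def by (simp add: blinfun.bilinear_simps Y(2) QY add.commute)
      define v where "v = x - P x"
      have "u \<bullet> (Q v + Y v) = 0" for u
        using orth[OF in_K, of u x] unfolding v_def[symmetric]
        by (simp add: inner_simps selfadjD[OF Q] selfadjD[OF Y(1)])
      then have "Q v + Y v = 0" by (metis inner_eq_zero_iff)
      then have "Q v = - Y v" by (simp add: eq_neg_iff_add_eq_0)
      then show ?thesis using Y(3)[of v] unfolding v_def by simp
    qed
  qed
qed

text \<open>Polarization: the form is tested at \<open>v + u\<close> and \<open>v - u\<close> with
  \<open>u\<close> a multiple of \<open>Q v\<close>, which stays in \<open>V\<close> by
  invariance.\<close>

lemma selfadj_norm_le:
  fixes Q :: "'a::real_inner \<Rightarrow>\<^sub>L 'a"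
  assumes Q: "selfadj Q" and V: "subspace V" "\<And>v. v \<in> V \<Longrightarrow> Q v \<in> V"
    and form: "\<And>v. v \<in> V \<Longrightarrow> \<bar>Q v \<bullet> v\<bar> \<le> c * (norm v)\<^sup>2" and v: "v \<in> V"
  shows "norm (Q v) \<le> c * norm v"
proof (cases "Q v = 0 \<or> v = 0")
  case True
  have "0 \<le> c * (norm v)\<^sup>2" using form[OF v] by linarith
  then have "v = 0 \<or> 0 \<le> c" by (auto simp: zero_le_mult_iff)
  then show ?thesis using True by auto
next
  case False
  \<comment> \<open>\<open>Q v\<close> is scaled to the length of \<open>v\<close>, so that the
    parallelogram law gives the constant \<open>c\<close> without loss.\<close>
  define u where "u = (norm v / norm (Q v)) *\<^sub>R Q v"
  have u: "u \<in> V" unfolding u_def using V v by (intro subspace_scale) auto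
  have norm_u: "norm u = norm v" unfolding u_def using False by simp
  have inner_u: "Q v \<bullet> u = norm v * norm (Q v)"
    unfolding u_def using False by (simp add: dot_square_norm power2_eq_square)
  have "4 * (Q v \<bullet> u) = Q (v + u) \<bullet> (v + u) - Q (v - u) \<bullet> (v - u)"
    using selfadjD[OF Q, of u v] by (simp add: blinfun.bilinear_simps inner_simps inner_commute)
  also have "\<dots> \<le> c * (norm (v + u))\<^sup>2 + c * (norm (v - u))\<^sup>2"
    using form[of "v + u"] form[of "v - u"] V(1) u v
    by (auto simp: subspace_add subspace_diff abs_le_iff)
  also have "\<dots> = 2 * c * ((norm v)\<^sup>2 + (norm u)\<^sup>2)"
    by (simp add: power2_norm_eq_inner inner_simps inner_commute algebra_simps)
  finally have "norm v * norm (Q v) \<le> norm v * (c * norm v)"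
    by (simp add: inner_u norm_u power2_eq_square algebra_simps)
  then show ?thesis using False by simp
qed

section \<open>Joint bisection of the spectrum\<close>

text \<open>The last clause puts \<open>P\<close> into the bicommutant of \<open>F\<close>, tested
  on adjointable operators. For commuting \<open>F\<close> this makes such projections commute with
  each other, with \<open>F\<close>, and with outside operators such as multiplication by i.\<close>

definition spectral_proj :: "('a::real_inner \<Rightarrow>\<^sub>L 'a) set \<Rightarrow> ('a \<Rightarrow>\<^sub>L 'a) \<Rightarrow> bool" where
  "spectral_proj F P \<longleftrightarrow> selfadj P \<and> (\<forall>x. P (P x) = P x) \<and>
     (\<forall>C. adjointable C \<longrightarrow> (\<forall>Q\<in>F. commute C Q) \<longrightarrow> commute C P)"

lemma spectral_projD:
  assumes "spectral_proj F P"
  shows "selfadj P" "P (P x) = P x"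
    "adjointable C \<Longrightarrow> (\<And>Q. Q \<in> F \<Longrightarrow> commute C Q) \<Longrightarrow> C (P x) = P (C x)"
  using assms unfolding spectral_proj_def commute_def by blast+

lemma spectral_proj_complement: "spectral_proj F P \<Longrightarrow> spectral_proj F (id_blinfun - P)"
  unfolding spectral_proj_def by (auto simp: blinfun.bilinear_simps)

lemma spectral_proj_pythagoras:
  assumes "spectral_proj F P"
  shows "(norm x)\<^sup>2 = (norm (P x))\<^sup>2 + (norm (x - P x))\<^sup>2"
proof -
  have "P x \<bullet> x = P x \<bullet> P x"
    using spectral_projD(1,2)[OF assms] by (metis inner_commute selfadjD)
  then show ?thesis by (simp add: power2_norm_eq_inner inner_simps inner_commute)
qed

definition commuting_family :: "('a::real_inner \<Rightarrow>\<^sub>L 'a) set \<Rightarrow> bool" where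
  "commuting_family F \<longleftrightarrow> (\<forall>Q\<in>F. selfadj Q) \<and> (\<forall>Q\<in>F. \<forall>T\<in>F. commute Q T)"

lemma spectral_proj_commute:
  assumes "commuting_family F" "spectral_proj F P"
  shows "Q \<in> F \<Longrightarrow> commute Q P"
  using assms unfolding commuting_family_def spectral_proj_def
  by (meson selfadj_adjointable)

text \<open>\<open>P\<close> commutes with all of \<open>F\<close>, so the bicommutant clause of
  \<open>P'\<close> applies to \<open>P\<close> itself.\<close>

lemma spectral_proj_compose:
  assumes F: "commuting_family F" and P: "spectral_proj F P" and P': "spectral_proj F P'"
  shows "spectral_proj F (P' o\<^sub>L P)" "commute P P'"
proof -
  have "commute P Q" if "Q \<in> F" for Q
    using spectral_proj_commute[OF F P that] by (rule commute_sym)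
  then show comm: "commute P P'"
    using P P' selfadj_adjointable unfolding spectral_proj_def by blast
  then show "spectral_proj F (P' o\<^sub>L P)"
    using P P' commute_sym[OF comm] unfolding spectral_proj_def
    by (auto simp: commute_def)
qed

text \<open>On the range of \<open>P\<close> this is \<open>a S \<le> X \<le> b S\<close> in the
  order of quadratic forms. For \<open>S = 1\<close> it confines the spectrum of \<open>X\<close>
  there to \<open>[a, b]\<close>; for \<open>X\<close> equal to \<open>S\<close> times an unbounded
  real part it confines that real part.\<close>

definition form_between ::
    "('a::real_inner \<Rightarrow>\<^sub>L 'a) \<Rightarrow> ('a \<Rightarrow>\<^sub>L 'a) \<Rightarrow> ('a \<Rightarrow>\<^sub>L 'a) \<Rightarrow> real \<Rightarrow> real \<Rightarrow> bool" where
  "form_between S X P a b \<longleftrightarrow>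
     (\<forall>x. a * (S (P x) \<bullet> P x) \<le> X (P x) \<bullet> P x \<and> X (P x) \<bullet> P x \<le> b * (S (P x) \<bullet> P x))"

lemma form_between_sub:
  fixes P P' :: "'a::real_inner \<Rightarrow>\<^sub>L 'a"
  assumes "form_between S X P a b" "\<And>x. P (P' x) = P' x"
  shows "form_between S X P' a b"
  using assms unfolding form_between_def by metis

text \<open>The interval is cut at its midpoint \<open>c\<close> by the spectral projection of
  \<open>X - c S\<close>. By Pythagoras at least one of the two halves keeps half of the squared
  norm of \<open>P z\<close>.\<close>

lemma spectral_bisection:
  fixes S X :: "'a::{real_inner,banach} \<Rightarrow>\<^sub>L 'a"
  assumes F: "commuting_family F" and S: "S \<in> F" and X: "X \<in> F"
    and P: "spectral_proj F P" and between: "form_between S X P a (a + l)" and l: "0 \<le> l"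
  obtains P' a' where "spectral_proj F P'" "\<And>x. P (P' x) = P' x" "a \<le> a'" "a' + l / 2 \<le> a + l"
    "form_between S X P' a' (a' + l / 2)" "(norm (P z))\<^sup>2 \<le> 2 * (norm (P' z))\<^sup>2"
proof -
  define c where "c = a + l / 2"
  have c_plus: "c + l / 2 = a + l" by (simp add: c_def)
  define Q where "Q = X - c *\<^sub>R S"
  have "selfadj Q" unfolding Q_def using F S X by (auto simp: commuting_family_def)
  then obtain P\<^sub>1 where P\<^sub>1: "selfadj P\<^sub>1" "\<And>x. P\<^sub>1 (P\<^sub>1 x) = P\<^sub>1 x"
    and comm: "\<And>C. adjointable C \<Longrightarrow> commute C Q \<Longrightarrow> commute C P\<^sub>1"
    and pos: "\<And>x. 0 \<le> Q (P\<^sub>1 x) \<bullet> P\<^sub>1 x" and neg: "\<And>x. Q (x - P\<^sub>1 x) \<bullet> (x - P\<^sub>1 x) \<le> 0"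
    using spectral_cut by blast
  have proj\<^sub>1: "spectral_proj F P\<^sub>1"
  proof -
    have "commute C Q" if "\<forall>T\<in>F. commute C T" for C
      unfolding Q_def using that S X by blast
    then show ?thesis unfolding spectral_proj_def using P\<^sub>1 comm by blast
  qed
  have Q_form: "Q x \<bullet> x = X x \<bullet> x - c * (S x \<bullet> x)" for x
    unfolding Q_def by (simp add: blinfun.bilinear_simps inner_simps)
  show thesis
  proof (cases "(norm (P z))\<^sup>2 \<le> 2 * (norm (P\<^sub>1 (P z)))\<^sup>2")
    case True
    have sub: "P ((P\<^sub>1 o\<^sub>L P) x) = (P\<^sub>1 o\<^sub>L P) x" for x
      using spectral_proj_compose(2)[OF F P proj\<^sub>1] spectral_projD(2)[OF P]
      by (simp add: commute_def)
    show thesis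
    proof (rule that)
      show "form_between S X (P\<^sub>1 o\<^sub>L P) c (c + l / 2)"
        using form_between_sub[OF between sub] pos
        unfolding form_between_def Q_form c_plus by simp
    qed (use l True spectral_proj_compose(1)[OF F P proj\<^sub>1] sub in \<open>auto simp: c_def\<close>)
  next
    case False
    define P\<^sub>2 where "P\<^sub>2 = id_blinfun - P\<^sub>1"
    have proj\<^sub>2: "spectral_proj F P\<^sub>2" unfolding P\<^sub>2_def using proj\<^sub>1 by (rule spectral_proj_complement)
    have sub: "P ((P\<^sub>2 o\<^sub>L P) x) = (P\<^sub>2 o\<^sub>L P) x" for x
      using spectral_proj_compose(2)[OF F P proj\<^sub>2] spectral_projD(2)[OF P]
      by (simp add: commute_def)
    show thesis
    proof (rule that)
      show "form_between S X (P\<^sub>2 o\<^sub>L P) a (a + l / 2)"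
        using form_between_sub[OF between sub] neg
        unfolding form_between_def Q_form c_def[symmetric]
        by (simp add: P\<^sub>2_def blinfun.bilinear_simps)
      show "(norm (P z))\<^sup>2 \<le> 2 * (norm ((P\<^sub>2 o\<^sub>L P) z))\<^sup>2"
        using False spectral_proj_pythagoras[OF proj\<^sub>1, of "P z"]
        by (simp add: P\<^sub>2_def blinfun.bilinear_simps)
    qed (use l spectral_proj_compose(1)[OF F P proj\<^sub>2] sub in auto)
  qed
qed

text \<open>The squared norms of \<open>P k w\<close> decrease, and by Pythagoras their differences
  are the squared distances of the vectors, so the sequence is Cauchy.\<close>

lemma decreasing_proj_converges:
  fixes P :: "nat \<Rightarrow> 'a::{real_inner,banach} \<Rightarrow>\<^sub>L 'a"
  assumes F: "commuting_family F" and P: "\<And>k. spectral_proj F (P k)"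
    and sub: "\<And>k x. P k (P (Suc k) x) = P (Suc k) x"
  obtains v where "(\<lambda>k. P k w) \<longlonglongrightarrow> v" "\<And>k. P k v = v"
proof -
  have below: "P k (P (k + d) x) = P (k + d) x" for k d x
  proof (induction d arbitrary: x)
    case (Suc d)
    show ?case using Suc[of "P (Suc (k + d)) x"] by (simp add: sub)
  qed (simp add: spectral_projD(2)[OF P])
  have diff: "(norm (P k w - P (k + d) w))\<^sup>2 = (norm (P k w))\<^sup>2 - (norm (P (k + d) w))\<^sup>2" for k d
  proof -
    have "P (k + d) (P k w) = P (k + d) w"
      using spectral_proj_compose(2)[OF F P P, of k "k + d"] below by (simp add: commute_def)
    then show ?thesis using spectral_proj_pythagoras[OF P, of "P k w" "k + d"] by simp
  qed
  have "decseq (\<lambda>k. (norm (P k w))\<^sup>2)"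
  proof (rule decseq_SucI)
    show "(norm (P (Suc k) w))\<^sup>2 \<le> (norm (P k w))\<^sup>2" for k
      using diff[of k 1] zero_le_power2[of "norm (P k w - P (k + 1) w)"] by simp
  qed
  then obtain l where "(\<lambda>k. (norm (P k w))\<^sup>2) \<longlonglongrightarrow> l"
    by (rule decseq_convergent[where B = 0]) auto
  then have cauchy: "Cauchy (\<lambda>k. (norm (P k w))\<^sup>2)" by (rule LIMSEQ_imp_Cauchy)
  have "Cauchy (\<lambda>k. P k w)"
  proof (rule metric_CauchyI)
    fix e :: real assume e: "0 < e"
    then obtain M where M: "\<And>i j. M \<le> i \<Longrightarrow> M \<le> j \<Longrightarrow>
        dist ((norm (P i w))\<^sup>2) ((norm (P j w))\<^sup>2) < e\<^sup>2"
      using metric_CauchyD[OF cauchy, of "e\<^sup>2"] by auto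
    have "dist (P i w) (P j w) < e" if ij: "M \<le> i" "i \<le> j" for i j
    proof (rule power2_less_imp_less)
      have "(norm (P i w))\<^sup>2 - (norm (P j w))\<^sup>2 < e\<^sup>2"
        using M[of i j] ij by (simp add: dist_real_def)
      then show "(dist (P i w) (P j w))\<^sup>2 < e\<^sup>2"
        using diff[of i "j - i"] ij by (simp add: dist_norm)
    qed (use e in simp)
    then show "\<exists>M. \<forall>i\<ge>M. \<forall>j\<ge>M. dist (P i w) (P j w) < e"
      by (metis dist_commute linorder_le_cases)
  qed
  then obtain v where v: "(\<lambda>k. P k w) \<longlonglongrightarrow> v" using Cauchy_convergent convergent_def by blast
  moreover have "P k v = v" for k
  proof -
    have "(\<lambda>d. P k (P (d + k) w)) \<longlonglongrightarrow> P k v"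
      by (intro tendsto_intros LIMSEQ_ignore_initial_segment v)
    moreover have "(\<lambda>d. P k (P (d + k) w)) \<longlonglongrightarrow> v"
      using LIMSEQ_ignore_initial_segment[OF v, of k] below[of k] by (simp add: add.commute)
    ultimately show ?thesis by (rule LIMSEQ_unique)
  qed
  ultimately show thesis by (rule that)
qed

text \<open>On the range of \<open>P\<close>, which \<open>X\<close> and \<open>S\<close> leave
  invariant, the form of \<open>X - \<alpha> S\<close> is at most \<open>l S\<close> in absolute
  value, and for a symmetric operator the form controls the norm.\<close>

lemma selfadj_restricted_norm_le:
  fixes S X :: "'a::{real_inner,banach} \<Rightarrow>\<^sub>L 'a"
  assumes F: "commuting_family F" and SX: "S \<in> F" "X \<in> F" and P: "spectral_proj F P"
    and between: "form_between S X P a (a + l)" and \<alpha>: "a \<le> \<alpha>" "\<alpha> \<le> a + l"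
    and pos: "\<And>x. 0 \<le> S x \<bullet> x" and v: "P v = v"
  shows "norm (X v - \<alpha> *\<^sub>R S v) \<le> l * norm S * norm v"
proof -
  define Q where "Q = X - \<alpha> *\<^sub>R S"
  have "norm (Q v) \<le> (l * norm S) * norm v"
  proof (rule selfadj_norm_le[where V = "{v. P v = v}"])
    show "selfadj Q" unfolding Q_def using F SX by (auto simp: commuting_family_def)
    show "subspace {v. P v = v}" by (simp add: subspace_def blinfun.bilinear_simps)
    show "Q u \<in> {v. P v = v}" if "u \<in> {v. P v = v}" for u
    proof -
      have "S (P u) = P (S u)" "X (P u) = P (X u)"
        using spectral_proj_commute[OF F P] SX by (simp_all add: commute_def)
      then show ?thesis using that unfolding Q_def by (simp add: blinfun.bilinear_simps)
    qed
    show "\<bar>Q u \<bullet> u\<bar> \<le> l * norm S * (norm u)\<^sup>2" if "u \<in> {v. P v = v}" for u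
    proof -
      have "a * (S u \<bullet> u) \<le> X u \<bullet> u" "X u \<bullet> u \<le> (a + l) * (S u \<bullet> u)"
        using between[unfolded form_between_def, rule_format, of u] that by simp_all
      moreover have "a * (S u \<bullet> u) \<le> \<alpha> * (S u \<bullet> u)" "\<alpha> * (S u \<bullet> u) \<le> (a + l) * (S u \<bullet> u)"
        using \<alpha> pos[of u] by (simp_all add: mult_right_mono)
      ultimately have "\<bar>X u \<bullet> u - \<alpha> * (S u \<bullet> u)\<bar> \<le> l * (S u \<bullet> u)"
        by (simp add: abs_le_iff algebra_simps)
      moreover have "S u \<bullet> u \<le> norm S * (norm u)\<^sup>2"
      proof -
        have "S u \<bullet> u \<le> norm (S u) * norm u" by (rule norm_cauchy_schwarz)
        also have "\<dots> \<le> (norm S * norm u) * norm u"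
          by (intro mult_right_mono norm_blinfun) simp
        finally show ?thesis by (simp add: power2_eq_square mult.assoc)
      qed
      then have "l * (S u \<bullet> u) \<le> l * (norm S * (norm u)\<^sup>2)"
        using \<alpha> by (intro mult_left_mono) auto
      ultimately show ?thesis
        unfolding Q_def by (simp add: blinfun.bilinear_simps inner_simps mult.assoc)
    qed
  qed (use v in simp)
  then show ?thesis unfolding Q_def by (simp add: blinfun.bilinear_simps)
qed

lemma nested_intervals_point:
  fixes a :: "nat \<Rightarrow> real"
  assumes "0 \<le> l" "\<And>k. a k \<le> a (Suc k)" "\<And>k. a (Suc k) + l / 2 ^ Suc k \<le> a k + l / 2 ^ k"
  obtains \<alpha> where "\<And>k. a k \<le> \<alpha>" "\<And>k. \<alpha> \<le> a k + l / 2 ^ k"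
proof -
  have "(\<lambda>k. l * (1 / 2) ^ k) \<longlonglongrightarrow> l * 0"
    by (intro tendsto_mult tendsto_const LIMSEQ_power_zero) simp
  from tendsto_minus[OF this] have "(\<lambda>k. a k - (a k + l / 2 ^ k)) \<longlonglongrightarrow> 0"
    by (simp add: power_one_over)
  then have "\<exists>\<alpha>. ((\<forall>k. a k \<le> \<alpha>) \<and> a \<longlonglongrightarrow> \<alpha>) \<and>
      ((\<forall>k. \<alpha> \<le> a k + l / 2 ^ k) \<and> (\<lambda>k. a k + l / 2 ^ k) \<longlonglongrightarrow> \<alpha>)"
    using assms by (intro nested_sequence_unique) auto
  then show thesis using that by blast
qed

text \<open>For \<open>T = X + iY\<close> normal and \<open>S = 1\<close> this says that the ranges of \<open>T - \<lambda>\<close> have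
  intersection 0; the weight \<open>S\<close> makes it applicable to unbounded operators. A nested sequence of
  spectral squares, each carrying at least a quarter of the mass of \<open>z\<close> of its predecessor,
  shrinks to a point \<open>\<lambda> = \<alpha> + i\<beta>\<close>. On the \<open>k\<close>-th square \<open>T - \<lambda>S\<close> has norm \<open>O(2\<^sup>-\<^sup>k)\<close>, while
  the projection of \<open>z\<close> has norm at least \<open>c 2\<^sup>-\<^sup>k\<close>, so the projections of a
  solution \<open>w\<close> of \<open>(T - \<lambda>S) w = S z\<close> cannot tend to 0. Subtracting their limit, which lies in
  the kernel of \<open>T - \<lambda>S\<close>, one gets a solution for which they do.\<close>

lemma common_range_trivial:
  fixes S X Y J :: "'a::{real_inner,banach} \<Rightarrow>\<^sub>L 'a"
  assumes F: "commuting_family {S, X, Y}"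
    and J: "adjointable J" "commute J S" "commute J X" "commute J Y" "\<And>x. norm (J x) = norm x"
    and pos: "\<And>x. x \<noteq> 0 \<Longrightarrow> 0 < S x \<bullet> x"
    and range: "\<And>\<alpha> \<beta>. \<exists>w. S z = X w - \<alpha> *\<^sub>R S w + J (Y w - \<beta> *\<^sub>R S w)"
  shows "z = 0"
proof (rule ccontr)
  assume z: "z \<noteq> 0"
  let ?F = "{S, X, Y}"
  have nonneg: "0 \<le> S x \<bullet> x" for x using pos[of x] by (cases "x = 0") auto
  \<comment> \<open>Half the Rayleigh quotient of \<open>S\<close> at \<open>z\<close>. Cutting
    \<open>S\<close> at this level leaves a nonzero part \<open>E z\<close>, and on the range of
    \<open>E\<close> the weight is bounded below by \<open>\<delta>\<close>, which allows
    \<open>X\<close> and \<open>Y\<close> to be enclosed between multiples of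
    \<open>S\<close>.\<close>
  define \<delta> where "\<delta> = (S z \<bullet> z) / (2 * (norm z)\<^sup>2)"
  have \<delta>: "0 < \<delta>" unfolding \<delta>_def using pos[OF z] z by simp
  define Q where "Q = S - \<delta> *\<^sub>R id_blinfun"
  have Q_form: "Q x \<bullet> x = S x \<bullet> x - \<delta> * (norm x)\<^sup>2" for x
    unfolding Q_def by (simp add: blinfun.bilinear_simps inner_simps power2_norm_eq_inner)
  have "selfadj Q" unfolding Q_def using F by (auto simp: commuting_family_def)
  then obtain E where E: "selfadj E" "\<And>x. E (E x) = E x"
    and comm: "\<And>C. adjointable C \<Longrightarrow> commute C Q \<Longrightarrow> commute C E"
    and Q_pos: "\<And>x. 0 \<le> Q (E x) \<bullet> E x" and Q_neg: "\<And>x. Q (x - E x) \<bullet> (x - E x) \<le> 0"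
    using spectral_cut by blast
  have E_proj: "spectral_proj ?F E"
  proof -
    have "commute C Q" if "\<forall>T\<in>?F. commute C T" for C
      unfolding Q_def using that by blast
    then show ?thesis unfolding spectral_proj_def using E comm by blast
  qed
  have S_ge: "\<delta> * (norm (E x))\<^sup>2 \<le> S (E x) \<bullet> E x" for x
    using Q_pos[of x] unfolding Q_form by simp
  have Ez: "E z \<noteq> 0"
  proof
    assume "E z = 0"
    then have "S z \<bullet> z \<le> \<delta> * (norm z)\<^sup>2" using Q_neg[of z] unfolding Q_form by simp
    also have "\<dots> = (S z \<bullet> z) / 2" unfolding \<delta>_def using z by simp
    finally show False using pos[OF z] by simp
  qed
  \<comment> \<open>\<open>norm X + norm Y\<close> bounds both operators at once, and
    \<open>\<delta> \<le> S\<close> on the range of \<open>E\<close> turns it into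
    \<open>K S\<close>: the initial square is \<open>[-K, K]\<close> in both directions.\<close>
  define K where "K = (norm X + norm Y) / \<delta>"
  have K: "0 \<le> K" unfolding K_def using \<delta> by simp
  have start: "form_between S T E (- K) (- K + 2 * K)" if "norm T \<le> norm X + norm Y" for T
    unfolding form_between_def
  proof
    fix x
    have "\<bar>T (E x) \<bullet> E x\<bar> \<le> norm (T (E x)) * norm (E x)" by (rule Cauchy_Schwarz_ineq2)
    also have "\<dots> \<le> (norm T * norm (E x)) * norm (E x)"
      by (intro mult_right_mono norm_blinfun) simp
    also have "\<dots> = norm T * (norm (E x))\<^sup>2" by (simp add: power2_eq_square)
    also have "\<dots> \<le> (K * \<delta>) * (norm (E x))\<^sup>2"
      using that \<delta> by (intro mult_right_mono) (auto simp: K_def)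
    also have "\<dots> \<le> K * (S (E x) \<bullet> E x)"
      using mult_left_mono[OF S_ge K] by (simp add: mult.assoc)
    finally show "- K * (S (E x) \<bullet> E x) \<le> T (E x) \<bullet> E x \<and>
        T (E x) \<bullet> E x \<le> (- K + 2 * K) * (S (E x) \<bullet> E x)"
      by (simp add: abs_le_iff)
  qed
  define L where "L = 2 * K"
  have L: "0 \<le> L" unfolding L_def using K by simp
  \<comment> \<open>The factor \<open>4 ^ k\<close> accounts for two bisections per step, one for
    \<open>X\<close> and one for \<open>Y\<close>, each losing at most half of the squared
    norm.\<close>
  define Inv where "Inv k s \<longleftrightarrow> (case s of (P, a, b) \<Rightarrow>
      spectral_proj ?F P \<and> (\<forall>x. E (blinfun_apply P x) = P x) \<and>
      form_between S X P a (a + L / 2 ^ k) \<and> form_between S Y P b (b + L / 2 ^ k) \<and>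
      (norm (E z))\<^sup>2 \<le> 4 ^ k * (norm (P z))\<^sup>2)" for k :: nat and s
  define Step where "Step k s s' \<longleftrightarrow> (case s of (P, a, b) \<Rightarrow> case s' of (P', a', b') \<Rightarrow>
      (\<forall>x. blinfun_apply P (blinfun_apply P' x) = P' x) \<and>
      a \<le> a' \<and> a' + L / 2 ^ Suc k \<le> a + L / 2 ^ k \<and>
      b \<le> b' \<and> b' + L / 2 ^ Suc k \<le> b + L / 2 ^ k)"
    for k :: nat and s s' :: "('a \<Rightarrow>\<^sub>L 'a) \<times> real \<times> real"
  have "\<exists>f. \<forall>k. Inv k (f k) \<and> Step k (f k) (f (Suc k))"
  proof (rule dependent_nat_choice)
    have "Inv 0 (E, - K, - K)"
      using E_proj E(2) start[of X] start[of Y] unfolding Inv_def by (simp add: L_def)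
    then show "\<exists>s. Inv 0 s" ..
    show "\<exists>s'. Inv (Suc k) s' \<and> Step k s s'" if "Inv k s" for s k
    proof -
      obtain P a b where s: "s = (P, a, b)" by (cases s)
      have P: "spectral_proj ?F P" "\<And>x. E (P x) = P x" "form_between S X P a (a + L / 2 ^ k)"
        "form_between S Y P b (b + L / 2 ^ k)" "(norm (E z))\<^sup>2 \<le> 4 ^ k * (norm (P z))\<^sup>2"
        using that unfolding Inv_def s by auto
      have L_k: "0 \<le> L / 2 ^ k" using L by simp
      obtain P' a' where P': "spectral_proj ?F P'" "\<And>x. P (P' x) = P' x"
          "a \<le> a'" "a' + L / 2 ^ k / 2 \<le> a + L / 2 ^ k"
          "form_between S X P' a' (a' + L / 2 ^ k / 2)" "(norm (P z))\<^sup>2 \<le> 2 * (norm (P' z))\<^sup>2"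
        by (rule spectral_bisection[OF F _ _ P(1) P(3) L_k, where z = z]) auto
      obtain P'' b' where P'': "spectral_proj ?F P''" "\<And>x. P' (P'' x) = P'' x"
          "b \<le> b'" "b' + L / 2 ^ k / 2 \<le> b + L / 2 ^ k"
          "form_between S Y P'' b' (b' + L / 2 ^ k / 2)" "(norm (P' z))\<^sup>2 \<le> 2 * (norm (P'' z))\<^sup>2"
        by (rule spectral_bisection[OF F _ _ P'(1) form_between_sub[OF P(4) P'(2)] L_k,
            where z = z]) auto
      have "(norm (E z))\<^sup>2 \<le> 4 ^ k * (4 * (norm (P'' z))\<^sup>2)"
      proof (rule order_trans[OF P(5)])
        show "4 ^ k * (norm (P z))\<^sup>2 \<le> 4 ^ k * (4 * (norm (P'' z))\<^sup>2)"
          using P'(6) P''(6) by (intro mult_left_mono) auto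
      qed
      moreover have sub: "P (P'' x) = P'' x" for x using P'(2) P''(2) by metis
      moreover have "E (P'' x) = P'' x" for x using P(2) sub by metis
      ultimately have "Inv (Suc k) (P'', a', b')" "Step k s (P'', a', b')"
        unfolding Inv_def Step_def s using P' P'' form_between_sub[OF P'(5) P''(2)]
        by (simp_all add: mult.commute mult.left_commute)
      then show ?thesis by blast
    qed
  qed
  then obtain f where Inv_f: "\<And>k. Inv k (f k)" and Step_f: "\<And>k. Step k (f k) (f (Suc k))"
    by blast
  define P a b where "P k = fst (f k)" and "a k = fst (snd (f k))" and "b k = snd (snd (f k))" for k
  have f: "f k = (P k, a k, b k)" for k by (simp add: P_def a_def b_def)
  have P: "spectral_proj ?F (P k)" "E (P k x) = P k x" "form_between S X (P k) (a k) (a k + L / 2 ^ k)"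
    "form_between S Y (P k) (b k) (b k + L / 2 ^ k)" "(norm (E z))\<^sup>2 \<le> 4 ^ k * (norm (P k z))\<^sup>2" for k x
    using Inv_f[of k] unfolding Inv_def f by auto
  have step: "P k (P (Suc k) x) = P (Suc k) x" "a k \<le> a (Suc k)" "b k \<le> b (Suc k)"
      "a (Suc k) + L / 2 ^ Suc k \<le> a k + L / 2 ^ k" "b (Suc k) + L / 2 ^ Suc k \<le> b k + L / 2 ^ k"
    for k x
    using Step_f[of k] unfolding Step_def f by auto
  obtain \<alpha> where \<alpha>: "\<And>k. a k \<le> \<alpha>" "\<And>k. \<alpha> \<le> a k + L / 2 ^ k"
    using nested_intervals_point[OF L step(2,4)] by blast
  obtain \<beta> where \<beta>: "\<And>k. b k \<le> \<beta>" "\<And>k. \<beta> \<le> b k + L / 2 ^ k"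
    using nested_intervals_point[OF L step(3,5)] by blast
  define T where "T = X - \<alpha> *\<^sub>R S + (J o\<^sub>L (Y - \<beta> *\<^sub>R S))"
  have T_apply: "T x = X x - \<alpha> *\<^sub>R S x + J (Y x - \<beta> *\<^sub>R S x)" for x
    unfolding T_def by (simp add: blinfun.bilinear_simps)
  obtain w where w: "T w = S z" using range[of \<alpha> \<beta>] unfolding T_apply by metis
  obtain v where v: "(\<lambda>k. P k w) \<longlonglongrightarrow> v" "\<And>k. P k v = v"
    using decreasing_proj_converges[where P = P, OF F P(1) step(1)] by blast
  have P_comm: "commute C (P k)" if "adjointable C" "\<And>Q. Q \<in> ?F \<Longrightarrow> commute C Q" for C k
    using P(1)[of k] that unfolding spectral_proj_def by blast
  have SP: "S (P k x) = P k (S x)" for k x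
    using spectral_proj_commute[OF F P(1), of S k] by (simp add: commute_def)
  have TP: "T (P k x) = P k (T x)" for k x
  proof -
    have "commute X (P k)" "commute Y (P k)" "commute J (P k)"
      using spectral_proj_commute[OF F P(1), of _ k] P_comm[OF J(1)] J(2-4) by auto
    then show ?thesis
      unfolding T_apply by (simp add: commute_def SP flip: blinfun.diff_right blinfun.add_right)
        (simp add: SP blinfun.bilinear_simps)
  qed
  have T_small: "norm (T x) \<le> 2 * (L / 2 ^ k * norm S) * norm x" if "P k x = x" for k x
  proof -
    have "norm (T x) \<le> norm (X x - \<alpha> *\<^sub>R S x) + norm (Y x - \<beta> *\<^sub>R S x)"
      unfolding T_apply using norm_triangle_ineq J(5) by metis
    also have "\<dots> \<le> L / 2 ^ k * norm S * norm x + L / 2 ^ k * norm S * norm x"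
      by (intro add_mono selfadj_restricted_norm_le[OF F _ _ P(1) P(3) \<alpha> nonneg that]
          selfadj_restricted_norm_le[OF F _ _ P(1) P(4) \<beta> nonneg that]) auto
    finally show ?thesis by (simp add: mult_ac)
  qed
  have "T v = 0"
  proof -
    have "norm (T v) \<le> 2 * (L * (1 / 2) ^ k * norm S) * norm v" for k
      using T_small[OF v(2), of k] by (simp add: power_one_over)
    moreover have "(\<lambda>k. 2 * (L * (1 / 2) ^ k * norm S) * norm v) \<longlonglongrightarrow> 2 * (L * 0 * norm S) * norm v"
      by (intro tendsto_intros LIMSEQ_power_zero) simp
    ultimately have "norm (T v) \<le> 2 * (L * 0 * norm S) * norm v"
      by (intro LIMSEQ_le_const) auto
    then show ?thesis by simp
  qed
  \<comment> \<open>The rates cancel: on the range of \<open>P k\<close> the operator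
    \<open>T\<close> is of order 2^-k, while \<open>norm (P k z)\<close> is at least 2^-k times
    \<open>norm (E z)\<close>. The left side is therefore independent of \<open>k\<close>, whereas
    the right side tends to 0.\<close>
  have "\<delta> * norm (E z) \<le> 2 * L * norm S * norm (P k w - v)" for k
  proof -
    have "\<delta> * (norm (P k z))\<^sup>2 \<le> S (P k z) \<bullet> P k z"
      using S_ge[of "P k z"] P(2) by simp
    also have "\<dots> \<le> norm (S (P k z)) * norm (P k z)" by (rule norm_cauchy_schwarz)
    finally have "\<delta> * norm (P k z) \<le> norm (S (P k z))"
      by (cases "P k z = 0") (simp_all add: power2_eq_square)
    also have "S (P k z) = T (P k w - v)"
      by (simp add: SP TP w blinfun.diff_right \<open>T v = 0\<close>)
    also have "norm \<dots> \<le> 2 * (L / 2 ^ k * norm S) * norm (P k w - v)"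
      by (rule T_small) (simp add: blinfun.diff_right v spectral_projD(2)[OF P(1)])
    finally have "2 ^ k * (\<delta> * norm (P k z)) \<le> 2 ^ k * (2 * (L / 2 ^ k * norm S) * norm (P k w - v))"
      by (intro mult_left_mono) simp_all
    then have "\<delta> * (2 ^ k * norm (P k z)) \<le> 2 * L * norm S * norm (P k w - v)"
      by (simp add: mult.left_commute)
    moreover have "norm (E z) \<le> 2 ^ k * norm (P k z)"
    proof (rule power2_le_imp_le)
      have "((2::real) ^ k)\<^sup>2 = 4 ^ k" by (simp add: power2_eq_square flip: power_mult_distrib)
      then show "(norm (E z))\<^sup>2 \<le> (2 ^ k * norm (P k z))\<^sup>2"
        using P(5) by (simp add: power_mult_distrib)
    qed simp
    then have "\<delta> * norm (E z) \<le> \<delta> * (2 ^ k * norm (P k z))"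
      using \<delta> by (intro mult_left_mono) auto
    ultimately show ?thesis by linarith
  qed
  moreover have "(\<lambda>k. 2 * L * norm S * norm (P k w - v)) \<longlonglongrightarrow> 2 * L * norm S * norm (v - v)"
    by (intro tendsto_intros v)
  ultimately have "\<delta> * norm (E z) \<le> 2 * L * norm S * norm (v - v)"
    by (intro LIMSEQ_le_const) auto
  then show False using \<delta> Ez by (simp add: mult_le_0_iff)
qed

section \<open>Unbounded normal operators\<close>

lemma scaleC_one [simp]: "1 *\<^sub>C x = x"
  using scaleC_of_real[of 1 x] by simp

lemma scaleC_scaleR: "c *\<^sub>C (r *\<^sub>R x) = r *\<^sub>R (c *\<^sub>C x)"
  by (simp add: scaleC_scaleC mult.commute flip: scaleC_of_real)

lemma inner_scaleC: "(c *\<^sub>C x) \<bullet> y = x \<bullet> (cnj c *\<^sub>C y)"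
proof -
  have "cinner x (cnj c *\<^sub>C y) = c * cinner x y"
    by (subst cinner_commute) (simp add: cinner_scaleC_left flip: cinner_commute)
  then show ?thesis by (simp add: cinner_scaleC_left flip: Re_cinner)
qed

lemma norm_scaleC: "norm (c *\<^sub>C x) = cmod c * norm x"
proof -
  have "(c *\<^sub>C x) \<bullet> (c *\<^sub>C x) = x \<bullet> (complex_of_real ((cmod c)\<^sup>2) *\<^sub>C x)"
    by (simp add: inner_scaleC scaleC_scaleC complex_norm_square mult.commute del: of_real_power)
  also have "\<dots> = (cmod c * norm x)\<^sup>2"
    unfolding scaleC_of_real by (simp add: dot_square_norm power_mult_distrib)
  finally show ?thesis by (simp add: norm_eq_sqrt_inner)
qed

lemma bounded_linear_scaleC: "bounded_linear ((*\<^sub>C) c)"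
  by (rule bounded_linear_intro[where K = "cmod c"])
    (simp_all add: scaleC_add_right scaleC_scaleR norm_scaleC mult.commute)

lemma scaleC_diff_right: "c *\<^sub>C (x - y) = c *\<^sub>C x - c *\<^sub>C y"
  using linear_diff[OF bounded_linear.linear[OF bounded_linear_scaleC]] .

lemma scaleC_zero_right [simp]: "c *\<^sub>C 0 = 0"
  using scaleC_diff_right[of c 0 0] by simp

lemma scaleC_minus_right: "c *\<^sub>C (- x) = - (c *\<^sub>C x)"
  using scaleC_diff_right[of c 0 x] by simp

lemma scaleC_minus_left: "(- c) *\<^sub>C x = - (c *\<^sub>C x)"
proof -
  have "(-1) *\<^sub>C x = - x" using scaleC_of_real[of "-1" x] by simp
  then show ?thesis using scaleC_scaleC[of c "-1" x] by (simp add: scaleC_minus_right)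
qed

lemma scaleC_diff_left: "(c - d) *\<^sub>C x = c *\<^sub>C x - d *\<^sub>C x"
  using scaleC_add_left[of c "- d" x] by (simp add: scaleC_minus_left)

text \<open>A normal operator \<open>m\<close> with domain \<open>D\<close> and its adjoint \<open>n\<close> with domain \<open>E\<close>; the real
  inner product suffices to express adjointness because the operators are complex linear.\<close>

locale normal_pair =
  fixes D E :: "'h::complex_hilbert_space set" and m n :: "'h \<Rightarrow> 'h"
  assumes adj_n: "y \<in> E \<and> n y = z \<longleftrightarrow> (\<forall>x\<in>D. m x \<bullet> y = x \<bullet> z)"
    and adj_m: "x \<in> D \<and> m x = u \<longleftrightarrow> (\<forall>y\<in>E. n y \<bullet> x = y \<bullet> u)"
    and normal_mn: "x \<in> D \<Longrightarrow> m x \<in> E \<Longrightarrow> x \<in> E \<and> n x \<in> D \<and> m (n x) = n (m x)"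
    and normal_nm: "x \<in> E \<Longrightarrow> n x \<in> D \<Longrightarrow> x \<in> D \<and> m x \<in> E \<and> n (m x) = m (n x)"
    and m_scaleC: "x \<in> D \<Longrightarrow> c *\<^sub>C x \<in> D \<and> m (c *\<^sub>C x) = c *\<^sub>C m x"
begin

section \<open>Linearity and closed graphs from adjointness\<close>

lemma adj: "x \<in> D \<Longrightarrow> y \<in> E \<Longrightarrow> m x \<bullet> y = x \<bullet> n y"
  using adj_n by blast

lemma n_scaleC: assumes "y \<in> E" shows "c *\<^sub>C y \<in> E \<and> n (c *\<^sub>C y) = c *\<^sub>C n y"
  unfolding adj_n
proof
  fix x assume "x \<in> D"
  then have "m (cnj c *\<^sub>C x) \<bullet> y = (cnj c *\<^sub>C x) \<bullet> n y" using m_scaleC assms by (intro adj) auto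
  then show "m x \<bullet> c *\<^sub>C y = x \<bullet> c *\<^sub>C n y" using m_scaleC[OF \<open>x \<in> D\<close>] by (simp add: inner_scaleC)
qed

text \<open>The axioms are symmetric, so each fact on \<open>m\<close> also serves for
  \<open>n\<close>; the interpretations \<open>sw\<close> rely on this.\<close>

lemma swap: "normal_pair E D n m"
  by unfold_locales (fact adj_m adj_n normal_nm normal_mn n_scaleC)+

text \<open>\<open>adj_m\<close> describes domain and value of \<open>m\<close> together by
  equations that are linear in the pair, so additivity follows from adjointness.\<close>

lemma m_add: assumes "x \<in> D" "y \<in> D" shows "x + y \<in> D \<and> m (x + y) = m x + m y"
  unfolding adj_m using assms adj by (simp add: inner_add_right inner_commute)

lemma m_scaleR: assumes "x \<in> D" shows "r *\<^sub>R x \<in> D \<and> m (r *\<^sub>R x) = r *\<^sub>R m x"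
  using m_scaleC[OF assms, of "complex_of_real r"] by (simp add: scaleC_of_real)

lemma m_zero: "0 \<in> D \<and> m 0 = 0"
  unfolding adj_m by simp

lemma m_diff: assumes "x \<in> D" "y \<in> D" shows "x - y \<in> D \<and> m (x - y) = m x - m y"
  unfolding adj_m using assms adj by (simp add: inner_diff_right inner_commute)

lemma subspace_D: "subspace D"
  unfolding subspace_def using m_zero m_add m_scaleR by blast

lemma subspace_graph: "subspace ((\<lambda>x. (x, m x)) ` D)"
  unfolding subspace_def
proof (intro conjI ballI allI)
  show "0 \<in> (\<lambda>x. (x, m x)) ` D" using m_zero by (auto simp: zero_prod_def image_iff)
qed (use m_add m_scaleR in \<open>auto simp: image_iff\<close>)

lemma closed_graph: "closed ((\<lambda>x. (x, m x)) ` D)"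
proof -
  have "(\<lambda>x. (x, m x)) ` D = {p. \<forall>y\<in>E. n y \<bullet> fst p = y \<bullet> snd p}"
    by (auto simp: image_iff adj_m[symmetric])
  moreover have "closed {p. \<forall>y\<in>E. n y \<bullet> fst p = y \<bullet> snd p}"
    unfolding Ball_def
    by (intro closed_Collect_all closed_Collect_imp open_Collect_const closed_Collect_eq
        continuous_intros)
  ultimately show ?thesis by simp
qed

lemma graph_decomposition:
  obtains a where "a \<in> D" "\<And>x. x \<in> D \<Longrightarrow> x \<bullet> (p - a) + m x \<bullet> (q - m a) = 0"
proof -
  obtain w where w: "w \<in> closure ((\<lambda>x. (x, m x)) ` D)"
    and orth: "\<And>v. v \<in> closure ((\<lambda>x. (x, m x)) ` D) \<Longrightarrow> v \<bullet> ((p, q) - w) = 0"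
    using orthogonal_decomposition[OF subspace_graph] by blast
  then obtain a where a: "a \<in> D" "w = (a, m a)"
    using closure_closed[OF closed_graph] by auto
  show thesis
  proof (rule that[OF a(1)])
    show "x \<bullet> (p - a) + m x \<bullet> (q - m a) = 0" if "x \<in> D" for x
      using orth[of "(x, m x)"] that a(2) closure_closed[OF closed_graph]
      by (auto simp: inner_Pair)
  qed
qed

text \<open>This is \<open>(1 + n m)^-1\<close>, everywhere defined by an argument of von Neumann;
  the next two lemmas justify the choice operator.\<close>

definition S :: "'h \<Rightarrow> 'h" where
  "S h = (SOME u. u \<in> D \<and> m u \<in> E \<and> u + n (m u) = h)"

text \<open>Project \<open>(h, 0)\<close> onto the graph of \<open>m\<close>: orthogonality of the
  residual says exactly that \<open>m u\<close> is in the domain of the adjoint and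
  \<open>n (m u) = h - u\<close>.\<close>

lemma S: "S h \<in> D" "m (S h) \<in> E" "S h + n (m (S h)) = h"
proof -
  obtain u where u: "u \<in> D" "\<And>x. x \<in> D \<Longrightarrow> x \<bullet> (h - u) + m x \<bullet> (0 - m u) = 0"
    using graph_decomposition[of h 0] by blast
  then have "\<forall>x\<in>D. m x \<bullet> m u = x \<bullet> (h - u)" by (simp add: algebra_simps)
  then have "m u \<in> E \<and> n (m u) = h - u" unfolding adj_n .
  then have "u \<in> D \<and> m u \<in> E \<and> u + n (m u) = h" using u(1) by simp
  then have "S h \<in> D \<and> m (S h) \<in> E \<and> S h + n (m (S h)) = h" unfolding S_def by (rule someI)
  then show "S h \<in> D" "m (S h) \<in> E" "S h + n (m (S h)) = h" by auto
qed

lemma S_unique: assumes u: "u \<in> D" "m u \<in> E" "u + n (m u) = h" shows "S h = u"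
proof -
  define d where "d = S h - u"
  have d: "d \<in> D" "m d = m (S h) - m u" unfolding d_def using m_diff S u by auto
  have "m d \<in> E \<and> n (m d) = n (m (S h)) - n (m u)"
    unfolding d(2) using normal_pair.m_diff[OF swap] S u by auto
  moreover have "d + (n (m (S h)) - n (m u)) = (S h + n (m (S h))) - (u + n (m u))"
    unfolding d_def by simp
  ultimately have "m d \<in> E" "d + n (m d) = 0" using S(3)[of h] u(3) by auto
  then have "d \<bullet> d + m d \<bullet> m d = d \<bullet> 0" using adj[OF d(1)] by (metis inner_add_right)
  then have "d \<bullet> d = 0" by (smt (verit) inner_ge_zero inner_zero_right)
  then show ?thesis unfolding d_def by simp
qed

text \<open>Expand \<open>y = S y + n (m (S y))\<close>. The right side is symmetric and positive,
  so self-adjointness, positivity and the norm bounds of \<open>S\<close> all come from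
  here.\<close>

lemma S_inner: "S x \<bullet> y = S x \<bullet> S y + m (S x) \<bullet> m (S y)"
  using adj[OF S(1)[of x] S(2)[of y]] S(3)[of y] by (metis inner_add_right)

section \<open>Equality of domains and norms of a normal operator and its adjoint\<close>

lemma norm_n_core: assumes "x \<in> D" "m x \<in> E" shows "norm (n x) = norm (m x)"
proof -
  have x: "x \<in> E" "n x \<in> D" "m (n x) = n (m x)" using normal_mn[OF assms] by auto
  have "n x \<bullet> n x = m x \<bullet> m x"
    using adj[OF x(2,1)] adj[OF assms] x(3) by (simp add: inner_commute)
  then show ?thesis by (simp add: norm_eq_sqrt_inner)
qed

text \<open>Let \<open>(p, q)\<close> be orthogonal to the graph over the vectors with
  \<open>m x \<in> E\<close>, and let \<open>(a, m a)\<close> be its projection onto the whole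
  graph. Testing with \<open>S a\<close>, for which \<open>S a + n (m (S a)) = a\<close>, gives
  \<open>a \<bullet> a = 0\<close>, so \<open>(p, q)\<close> is orthogonal to the whole
  graph.\<close>

lemma core:
  assumes "x \<in> D"
  obtains u where "\<And>k. u k \<in> D" "\<And>k. m (u k) \<in> E" "u \<longlonglongrightarrow> x" "(\<lambda>k. m (u k)) \<longlonglongrightarrow> m x"
proof -
  define V where "V = (\<lambda>x. (x, m x)) ` {x \<in> D. m x \<in> E}"
  interpret sw: normal_pair E D n m by (rule swap)
  have "subspace V"
    unfolding V_def subspace_def
  proof (intro conjI ballI allI)
    show "0 \<in> (\<lambda>x. (x, m x)) ` {x \<in> D. m x \<in> E}"
      using m_zero sw.m_zero by (auto simp: zero_prod_def image_iff)
  qed (use m_add m_scaleR sw.m_add sw.m_scaleR in \<open>auto simp: image_iff\<close>)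
  moreover have "(x, m x) \<bullet> y = 0" if orth: "\<And>v. v \<in> V \<Longrightarrow> v \<bullet> y = 0" for y
  proof -
    obtain p q where y: "y = (p, q)" by (cases y)
    obtain a where a: "a \<in> D" "\<And>x. x \<in> D \<Longrightarrow> x \<bullet> (p - a) + m x \<bullet> (q - m a) = 0"
      using graph_decomposition[of p q] by blast
    have "(S a, m (S a)) \<in> V" unfolding V_def using S by blast
    then have "S a \<bullet> p + m (S a) \<bullet> q = 0" using orth[of "(S a, m (S a))"] y by (simp add: inner_Pair)
    then have "S a \<bullet> a + m (S a) \<bullet> m a = 0" using a(2)[OF S(1), of a] by (simp add: inner_diff_right)
    moreover have "m (S a) \<bullet> m a = n (m (S a)) \<bullet> a"
      using adj[OF a(1) S(2), of a] by (simp add: inner_commute)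
    ultimately have "(S a + n (m (S a))) \<bullet> a = 0" by (simp add: inner_add_left)
    then have "a = 0" using S(3) by simp
    then show ?thesis using a(2)[OF assms] m_zero y by (simp add: inner_Pair)
  qed
  ultimately have "(x, m x) \<in> closure V" by (rule in_closure_if_orthogonal)
  then obtain f where f: "\<And>k. f k \<in> V" "f \<longlonglongrightarrow> (x, m x)" unfolding closure_sequential by blast
  have f_eq: "f k = (fst (f k), m (fst (f k)))" "fst (f k) \<in> D" "m (fst (f k)) \<in> E" for k
    using f(1)[of k] unfolding V_def by auto
  have "snd (f k) = m (fst (f k))" for k using f_eq(1)[of k] by (metis snd_conv)
  then show thesis
    using that[of "\<lambda>k. fst (f k)"] f_eq(2,3) tendsto_fst[OF f(2)] tendsto_snd[OF f(2)] by simp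
qed

text \<open>Along a core sequence \<open>n\<close> inherits the Cauchy property from
  \<open>m\<close> by equality of norms, and the equations defining the adjoint pass to the
  limit.\<close>

lemma norm_n: assumes "x \<in> D" shows "x \<in> E \<and> norm (n x) = norm (m x)"
proof -
  interpret sw: normal_pair E D n m by (rule swap)
  obtain u where u: "\<And>k. u k \<in> D" "\<And>k. m (u k) \<in> E" "u \<longlonglongrightarrow> x" "(\<lambda>k. m (u k)) \<longlonglongrightarrow> m x"
    using core[OF assms] by blast
  have uE: "u k \<in> E" for k using normal_mn u by blast
  have "dist (n (u i)) (n (u j)) = dist (m (u i)) (m (u j))" for i j
  proof -
    have "u i - u j \<in> D" "m (u i - u j) = m (u i) - m (u j)" using m_diff u by auto
    moreover have "m (u i) - m (u j) \<in> E" using sw.m_diff u by blast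
    moreover have "n (u i - u j) = n (u i) - n (u j)" using sw.m_diff uE by blast
    ultimately show ?thesis using norm_n_core[of "u i - u j"] by (simp add: dist_norm)
  qed
  then have "Cauchy (\<lambda>k. n (u k))"
    using LIMSEQ_imp_Cauchy[OF u(4)] by (simp add: Cauchy_def)
  then obtain g where g: "(\<lambda>k. n (u k)) \<longlonglongrightarrow> g" using Cauchy_convergent convergent_def by blast
  have "m w \<bullet> x = w \<bullet> g" if "w \<in> D" for w
  proof (rule LIMSEQ_unique)
    show "(\<lambda>k. m w \<bullet> u k) \<longlonglongrightarrow> m w \<bullet> x" by (intro tendsto_intros u)
    show "(\<lambda>k. m w \<bullet> u k) \<longlonglongrightarrow> w \<bullet> g"
      using adj[OF that uE] by (simp add: tendsto_inner[OF tendsto_const g])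
  qed
  then have x: "x \<in> E \<and> n x = g" unfolding adj_n by blast
  moreover have "norm g = norm (m x)"
  proof (rule LIMSEQ_unique[OF tendsto_norm[OF g]])
    show "(\<lambda>k. norm (n (u k))) \<longlonglongrightarrow> norm (m x)"
      using norm_n_core u tendsto_norm[OF u(4)] by simp
  qed
  ultimately show ?thesis by simp
qed

lemma D_eq_E: "E = D"
  using norm_n normal_pair.norm_n[OF swap] by blast

text \<open>Expanding both squares, the cross terms agree by adjointness: \<open>m - c\<close> is
  again normal.\<close>

lemma norm_shift:
  assumes x: "x \<in> D"
  shows "norm (n x - cnj c *\<^sub>C x) = norm (m x - c *\<^sub>C x)"
proof -
  have "norm (n x) = norm (m x)" using norm_n[OF x] by simp
  then have "n x \<bullet> n x = m x \<bullet> m x" by (simp add: norm_eq_sqrt_inner)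
  moreover have "m x \<bullet> c *\<^sub>C x = n x \<bullet> cnj c *\<^sub>C x"
  proof -
    have "x \<in> E" using x D_eq_E by simp
    then have "m x \<bullet> c *\<^sub>C x = x \<bullet> c *\<^sub>C n x" using n_scaleC[of x c] adj[OF x, of "c *\<^sub>C x"] by simp
    then show ?thesis using inner_scaleC[of c "n x" x] by (simp add: inner_commute)
  qed
  moreover have "cnj c *\<^sub>C x \<bullet> cnj c *\<^sub>C x = c *\<^sub>C x \<bullet> c *\<^sub>C x"
    by (simp add: dot_square_norm norm_scaleC)
  ultimately have "(n x - cnj c *\<^sub>C x) \<bullet> (n x - cnj c *\<^sub>C x) = (m x - c *\<^sub>C x) \<bullet> (m x - c *\<^sub>C x)"
    by (simp add: inner_diff_left inner_diff_right inner_commute)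
  then show ?thesis by (simp add: norm_eq_sqrt_inner)
qed

text \<open>The functional \<open>y \<bullet> u\<close> equals the inner product of
  \<open>(m - c) y\<close> with \<open>x\<close>, hence is at most \<open>norm x\<close> times the
  norm of \<open>(n - cnj c) y\<close> by \<open>norm_shift\<close>. So it factors through
  \<open>n - cnj c\<close>, and the representing vector \<open>w\<close> is the preimage because
  \<open>m\<close> is the adjoint of \<open>n\<close>.\<close>

lemma range_adjoint:
  assumes x: "x \<in> D"
  obtains w where "w \<in> D" "n x - cnj c *\<^sub>C x = m w - c *\<^sub>C w"
proof -
  interpret sw: normal_pair E D n m by (rule swap)
  define u where "u = n x - cnj c *\<^sub>C x"
  have xE: "x \<in> E" using x D_eq_E by simp
  have g: "y \<bullet> u = (m y - c *\<^sub>C y) \<bullet> x" if "y \<in> D" for y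
    unfolding u_def using adj[OF that xE] by (simp add: inner_diff_left inner_diff_right inner_scaleC)
  obtain w where w: "\<And>y. y \<in> E \<Longrightarrow> y \<bullet> u = (n y - cnj c *\<^sub>C y) \<bullet> w"
  proof (rule riesz_dominated[OF sw.subspace_D, where L = "\<lambda>y. n y - cnj c *\<^sub>C y"
        and g = "\<lambda>y. y \<bullet> u" and K = "norm x"])
    show "n (y + y') - cnj c *\<^sub>C (y + y') = n y - cnj c *\<^sub>C y + (n y' - cnj c *\<^sub>C y')"
      if "y \<in> E" "y' \<in> E" for y y'
      using sw.m_add[OF that] by (simp add: scaleC_add_right)
    show "n (r *\<^sub>R y) - cnj c *\<^sub>C r *\<^sub>R y = r *\<^sub>R (n y - cnj c *\<^sub>C y)" if "y \<in> E" for r y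
      using sw.m_scaleR[OF that] by (simp add: scaleC_scaleR scaleR_diff_right)
    show "\<bar>y \<bullet> u\<bar> \<le> norm x * norm (n y - cnj c *\<^sub>C y)" if "y \<in> E" for y
    proof -
      have y: "y \<in> D" using that D_eq_E by simp
      show ?thesis unfolding g[OF y] norm_shift[OF y]
        using Cauchy_Schwarz_ineq2[of "m y - c *\<^sub>C y" x] by (simp add: mult.commute)
    qed
  qed (auto simp: inner_add_left)
  have "w \<in> D \<and> m w = u + c *\<^sub>C w"
    unfolding adj_m
  proof
    fix y assume "y \<in> E"
    then show "n y \<bullet> w = y \<bullet> (u + c *\<^sub>C w)"
      using w[of y] by (simp add: inner_diff_left inner_add_right inner_scaleC)
  qed
  then show thesis using that[of w] by (simp add: u_def)
qed

text \<open>Apply \<open>m\<close> to \<open>S x + n (m (S x)) = x\<close> and exchange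
  \<open>m\<close> and \<open>n\<close> by normality; uniqueness does the rest.\<close>

lemma S_m: assumes x: "x \<in> D" shows "S (m x) = m (S x)"
proof (rule S_unique)
  have v: "m (S x) \<in> E" "n (m (S x)) = x - S x" using S[of x] by (simp_all add: eq_diff_eq add.commute)
  have "n (m (S x)) \<in> D" "m (n (m (S x))) = m x - m (S x)"
    unfolding v(2) using m_diff[OF x S(1)] by auto
  then show "m (S x) \<in> D" "m (m (S x)) \<in> E" "m (S x) + n (m (m (S x))) = m x"
    using normal_nm[OF v(1)] by auto
qed

lemma S_n: assumes x: "x \<in> D" shows "S (n x) = n (S x)"
proof (rule S_unique)
  interpret sw: normal_pair E D n m by (rule swap)
  have u: "S x \<in> E" "n (S x) \<in> D" "m (n (S x)) = n (m (S x))" using normal_mn[OF S(1,2)] by auto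
  have eq: "m (n (S x)) = x - S x" using S(3)[of x] u(3) by (simp add: eq_diff_eq add.commute)
  have "x - S x \<in> E" "n (x - S x) = n x - n (S x)" using sw.m_diff x S(1) D_eq_E by auto
  then show "n (S x) \<in> D" "m (n (S x)) \<in> E" "n (S x) + n (m (n (S x))) = n x"
    using u eq by auto
qed

lemma S_add: "S (x + y) = S x + S y"
proof (rule S_unique)
  interpret sw: normal_pair E D n m by (rule swap)
  have *: "S x + S y \<in> D" "m (S x + S y) = m (S x) + m (S y)" using m_add S by auto
  then show "S x + S y \<in> D" "m (S x + S y) \<in> E" using sw.m_add S by auto
  have "n (m (S x) + m (S y)) = n (m (S x)) + n (m (S y))" using sw.m_add S by auto
  then show "S x + S y + n (m (S x + S y)) = x + y"
    using S(3)[of x] S(3)[of y] unfolding * by (simp add: algebra_simps)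
qed

lemma S_scaleC: "S (c *\<^sub>C x) = c *\<^sub>C S x"
proof (rule S_unique)
  have *: "c *\<^sub>C S x \<in> D" "m (c *\<^sub>C S x) = c *\<^sub>C m (S x)" using m_scaleC S by auto
  then show "c *\<^sub>C S x \<in> D" "m (c *\<^sub>C S x) \<in> E" using n_scaleC S by auto
  have "n (c *\<^sub>C m (S x)) = c *\<^sub>C n (m (S x))" using n_scaleC S by auto
  then show "c *\<^sub>C S x + n (m (c *\<^sub>C S x)) = c *\<^sub>C x"
    unfolding * using S(3)[of x] by (simp flip: scaleC_add_right)
qed

lemma S_bounds: "norm (S x) \<le> norm x" "norm (m (S x)) \<le> norm x"
proof -
  have eq: "S x \<bullet> x = (norm (S x))\<^sup>2 + (norm (m (S x)))\<^sup>2"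
    using S_inner[of x x] by (simp add: dot_square_norm)
  have le: "S x \<bullet> x \<le> norm (S x) * norm x" by (rule norm_cauchy_schwarz)
  have "norm (S x) * norm (S x) \<le> norm (S x) * norm x"
    using eq le zero_le_power2[of "norm (m (S x))"] unfolding power2_eq_square by linarith
  then show *: "norm (S x) \<le> norm x" by (cases "S x = 0") auto
  have "(norm (m (S x)))\<^sup>2 \<le> norm (S x) * norm x"
    using eq le zero_le_power2[of "norm (S x)"] by linarith
  also have "\<dots> \<le> norm x * norm x" using * by (intro mult_right_mono) auto
  finally show "norm (m (S x)) \<le> norm x"
    using power2_le_imp_le[of "norm (m (S x))" "norm x"] by (simp add: power2_eq_square)
qed

text \<open>Expanding \<open>y = S y + m (n (S y))\<close> on one side and
  \<open>x = S x + n (m (S x))\<close> on the other produces the same two terms.\<close>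

lemma adj_mS: "m (S x) \<bullet> y = x \<bullet> n (S y)"
proof -
  have v: "S y \<in> E" "n (S y) \<in> D" "m (n (S y)) = n (m (S y))" using normal_mn[OF S(1,2)] by auto
  have "m (S x) \<bullet> y = m (S x) \<bullet> S y + m (S x) \<bullet> m (n (S y))"
    using S(3)[of y] v(3) by (metis inner_add_right)
  also have "m (S x) \<bullet> S y = S x \<bullet> n (S y)" by (rule adj[OF S(1) v(1)])
  also have "m (S x) \<bullet> m (n (S y)) = n (m (S x)) \<bullet> n (S y)"
    using adj[OF v(2) S(2), of x] by (simp add: inner_commute)
  finally show ?thesis using S(3)[of x] by (metis inner_add_left)
qed

text \<open>Applying \<open>S\<close> to \<open>z = (m - c) w\<close> gives
  \<open>S z = (m S - c S) w\<close>, an equation between bounded operators; the weighted result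
  applies with \<open>m S = X + J Y\<close>.\<close>

lemma common_range_zero:
  assumes "\<And>c. \<exists>w\<in>D. z = m w - c *\<^sub>C w"
  shows "z = 0"
proof -
  interpret sw: normal_pair E D n m by (rule swap)
  have SE: "S x \<in> E" for x using S(1) D_eq_E by simp
  define bS where "bS = Blinfun S"
  define bT where "bT = Blinfun (\<lambda>x. m (S x))"
  define bT' where "bT' = Blinfun (\<lambda>x. n (S x))"
  define J :: "'h \<Rightarrow>\<^sub>L 'h" where "J = Blinfun ((*\<^sub>C) \<i>)"
  have S_scaleR: "S (r *\<^sub>R x) = r *\<^sub>R S x" for r x
    using S_scaleC[of "complex_of_real r" x] by (simp add: scaleC_of_real)
  have bS [simp]: "bS x = S x" for x
    unfolding bS_def
    by (subst bounded_linear_Blinfun_apply)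
      (auto intro!: bounded_linear_intro[where K = 1] simp: S_add S_scaleR S_bounds)
  have bT [simp]: "bT x = m (S x)" for x
    unfolding bT_def
    by (subst bounded_linear_Blinfun_apply)
      (auto intro!: bounded_linear_intro[where K = 1]
        simp: S_add S_scaleR S_bounds m_add m_scaleR S(1))
  have bT' [simp]: "bT' x = n (S x)" for x
    unfolding bT'_def
    by (subst bounded_linear_Blinfun_apply)
      (auto intro!: bounded_linear_intro[where K = 1]
        simp: S_add S_scaleR S_bounds sw.m_add sw.m_scaleR SE norm_n S(1))
  have J [simp]: "J x = \<i> *\<^sub>C x" for x
    unfolding J_def by (simp add: bounded_linear_Blinfun_apply bounded_linear_scaleC)
  have SD: "n (S x) \<in> D" "m (S x) \<in> D" for x using normal_mn[OF S(1,2)] S(2) D_eq_E by auto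
  have commT: "commute bS bT" "commute bS bT'" "commute bT bT'"
  proof -
    show "commute bS bT" by (simp add: commute_def S_m S(1))
    show "commute bS bT'" by (simp add: commute_def S_n S(1))
    have "m (n (S (S x))) = n (m (S (S x)))" for x using normal_mn[OF S(1,2)] by blast
    then show "commute bT bT'" by (simp add: commute_def S_n S_m S(1))
  qed
  have commJ: "commute J bS" "commute J bT" "commute J bT'"
    by (simp_all add: commute_def S_scaleC m_scaleC n_scaleC S(1) SE)
  have adj_J: "J x \<bullet> y = x \<bullet> (- J) y" for x y
    by (simp add: inner_scaleC scaleC_minus_left blinfun.bilinear_simps)
  define X where "X = (1/2) *\<^sub>R (bT + bT')"
  \<comment> \<open>The imaginary part \<open>(bT - bT') / 2i\<close>, with \<open>- J / 2\<close>
    in place of the division by 2i.\<close>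
  define Y where "Y = (- 1/2) *\<^sub>R (J o\<^sub>L (bT - bT'))"
  have JX: "commute J X" unfolding X_def using commJ by blast
  have JY: "commute J Y" unfolding Y_def using commJ by blast
  have SX: "commute bS X" unfolding X_def using commT by blast
  have SY: "commute bS Y"
    unfolding Y_def using commT commute_sym[OF commJ(1)] by blast
  have TY: "commute C Y" if "commute C bT" "commute C bT'" "commute C J" for C
    unfolding Y_def using that by blast
  have XY: "commute X Y"
  proof -
    have "commute bT X" "commute bT' X"
      unfolding X_def using commT commute_sym by blast+
    then show ?thesis using commute_sym JX by (intro TY) blast+
  qed
  have JJ: "J (J x) = - x" for x
    using scaleC_minus_left[of 1 x] by (simp add: scaleC_scaleC)
  have sa: "selfadj bS" "selfadj X" "selfadj Y"
  proof -
    show "selfadj bS" unfolding selfadj_def bS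
      using S_inner by (metis inner_commute)
    have T: "bT x \<bullet> y = x \<bullet> bT' y" "bT' x \<bullet> y = x \<bullet> bT y" for x y
      using adj_mS[of x y] adj_mS[of y x] by (simp_all add: inner_commute)
    show "selfadj X"
      unfolding selfadj_def X_def using T by (simp add: blinfun.bilinear_simps inner_simps del: bT bT')
    have "J ((bT - bT') x) \<bullet> y = x \<bullet> J ((bT - bT') y)" for x y
    proof -
      have "J ((bT - bT') x) \<bullet> y = - ((bT - bT') x \<bullet> J y)"
        unfolding adj_J by (simp add: blinfun.bilinear_simps del: J)
      also have "\<dots> = x \<bullet> (bT - bT') (J y)"
        using T by (simp add: blinfun.bilinear_simps inner_simps del: bT bT' J)
      also have "(bT - bT') (J y) = J ((bT - bT') y)"
        using commJ(2,3) unfolding commute_def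
        by (simp add: blinfun.bilinear_simps del: bT bT' J)
      finally show ?thesis .
    qed
    then show "selfadj Y"
      unfolding selfadj_def Y_def by (simp add: blinfun.scaleR_left blinfun.minus_left del: J)
  qed
  show ?thesis
  proof (rule common_range_trivial)
    show "commuting_family {bS, X, Y}"
      unfolding commuting_family_def using sa SX SY XY commute_sym by blast
    show "adjointable J" unfolding adjointable_def using adj_J by blast
    show "commute J bS" "commute J X" "commute J Y" by (rule commJ JX JY)+
    show "norm (J x) = norm x" for x by (simp add: norm_scaleC)
    show "0 < bS x \<bullet> x" if "x \<noteq> 0" for x
    proof -
      have "S x \<noteq> 0" using S(3)[of x] m_zero sw.m_zero that by auto
      then have "0 < S x \<bullet> S x" by simp
      then show ?thesis unfolding bS S_inner[of x x] by (rule add_pos_nonneg) (rule inner_ge_zero)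
    qed
    fix \<alpha> \<beta>
    define c where "c = Complex \<alpha> \<beta>"
    obtain w where w: "w \<in> D" "z = m w - c *\<^sub>C w" using assms by blast
    have "S (m w - c *\<^sub>C w) = m (S w) - c *\<^sub>C S w"
      using S_add[of "m w - c *\<^sub>C w" "c *\<^sub>C w"] w by (simp add: S_scaleC S_m eq_diff_eq)
    then have Sz: "bS z = bT w - c *\<^sub>C S w" using w by simp
    have JYw: "J (Y w) = (1/2) *\<^sub>R (bT w - bT' w)"
      unfolding Y_def by (simp add: blinfun.bilinear_simps JJ scaleR_diff_right del: J bT bT')
    have "c *\<^sub>C S w = \<alpha> *\<^sub>R S w + \<beta> *\<^sub>R J (S w)"
    proof -
      have "c = complex_of_real \<alpha> + complex_of_real \<beta> * \<i>" unfolding c_def by (simp add: complex_eq_iff)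
      then show ?thesis by (simp add: scaleC_add_left scaleC_of_real flip: scaleC_scaleC)
    qed
    then have "bS z = X w - \<alpha> *\<^sub>R bS w + J (Y w - \<beta> *\<^sub>R bS w)"
      unfolding Sz blinfun.diff_right blinfun.scaleR_right JYw X_def
      by (simp add: blinfun.bilinear_simps del: J bT bT') (simp add: algebra_simps flip: scaleR_add_left)
    then show "\<exists>w. bS z = X w - \<alpha> *\<^sub>R bS w + J (Y w - \<beta> *\<^sub>R bS w)" by blast
  qed
qed

text \<open>The commutator \<open>R n y - n R y\<close> lies in the range of every \<open>m - c\<close>: by \<open>range_adjoint\<close> both
  \<open>(n - cnj c) y\<close> and \<open>(n - cnj c) R y\<close> do, and \<open>R\<close> preserves these ranges. No continuity of \<open>R\<close> is
  needed.\<close>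

theorem algebraic_fuglede:
  assumes R_add: "\<And>x y. R (x + y) = R x + R y" and R_scaleC: "\<And>c x. R (c *\<^sub>C x) = c *\<^sub>C R x"
    and comm: "\<And>y. y \<in> D \<Longrightarrow> R y \<in> D \<and> R (m y) = m (R y)" and y: "y \<in> D"
  shows "R (n y) = n (R y)"
proof -
  have R_diff: "R (x - y) = R x - R y" for x y using R_add[of "x - y" y] by simp
  have "R (n y) - n (R y) = 0"
  proof (rule common_range_zero)
    fix c
    obtain w where w: "w \<in> D" "n y - cnj c *\<^sub>C y = m w - c *\<^sub>C w" using range_adjoint[OF y] .
    obtain w' where w': "w' \<in> D" "n (R y) - cnj c *\<^sub>C R y = m w' - c *\<^sub>C w'"
      using range_adjoint[of "R y"] comm[OF y] by blast
    have Rn: "R (n y) = m (R w) - c *\<^sub>C R w + cnj c *\<^sub>C R y"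
      using arg_cong[OF w(2), of R] comm[OF w(1)] by (simp add: R_diff R_scaleC diff_eq_eq)
    have nR: "n (R y) = m w' - c *\<^sub>C w' + cnj c *\<^sub>C R y"
      using w'(2) by (simp add: diff_eq_eq)
    have "m (R w - w') = m (R w) - m w'" using m_diff[of "R w" w'] comm[OF w(1)] w'(1) by blast
    then have "R (n y) - n (R y) = m (R w - w') - c *\<^sub>C (R w - w')"
      unfolding Rn nR by (simp add: scaleC_diff_right)
    then show "\<exists>v\<in>D. R (n y) - n (R y) = m v - c *\<^sub>C v"
      using m_diff[of "R w" w'] comm[OF w(1)] w'(1) by blast
  qed
  then show ?thesis by simp
qed

end

section \<open>Adjoints and closures of partial operators\<close>

lemma scaleC_sum: "c *\<^sub>C (\<Sum>k\<in>K. f k) = (\<Sum>k\<in>K. c *\<^sub>C f k)"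
  by (rule linear_sum[OF bounded_linear.linear[OF bounded_linear_scaleC]])

text \<open>The imaginary part of \<open>cinner a b\<close> is minus the real inner product of i a
  with \<open>b\<close>, and the domain is stable under multiplication by i.\<close>

lemma adjoint_at_iff_inner:
  assumes "linear_operator T"
  shows "adjoint_at T y z \<longleftrightarrow> (\<forall>x\<in>dom T. the (T x) \<bullet> y = x \<bullet> z)"
proof
  assume "adjoint_at T y z"
  then show "\<forall>x\<in>dom T. the (T x) \<bullet> y = x \<bullet> z"
    by (simp add: adjoint_at_def flip: Re_cinner)
next
  assume *: "\<forall>x\<in>dom T. the (T x) \<bullet> y = x \<bullet> z"
  have Im: "Im (cinner a b) = - ((\<i> *\<^sub>C a) \<bullet> b)" for a b :: 'a
    by (simp add: cinner_scaleC_left flip: Re_cinner)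
  show "adjoint_at T y z"
    unfolding adjoint_at_def
  proof
    fix x assume x: "x \<in> dom T"
    then have "\<i> *\<^sub>C x \<in> dom T" "the (T (\<i> *\<^sub>C x)) = \<i> *\<^sub>C the (T x)"
      using assms by (auto simp: linear_operator_def)
    then have "(\<i> *\<^sub>C the (T x)) \<bullet> y = (\<i> *\<^sub>C x) \<bullet> z" using * by metis
    then show "cinner (the (T x)) y = cinner x z"
      using * x by (intro complex_eqI) (simp_all add: Im Re_cinner)
  qed
qed

text \<open>The substance is \<open>adj_m\<close>, the fact that a closed densely defined operator
  is its own double adjoint.\<close>

lemma normal_operator_pair:
  assumes "normal_operator M"
  shows "normal_pair (dom M) (dom (op_adjoint M)) (\<lambda>x. the (M x)) (\<lambda>x. the (op_adjoint M x))"
proof -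
  have lin: "linear_operator M" and dense: "densely_defined M" and closed: "closed (Map.graph M)"
    and normal: "M \<circ>\<^sub>m op_adjoint M = op_adjoint M \<circ>\<^sub>m M"
    using assms by (auto simp: normal_operator_def closed_operator_def)
  have adj_n: "y \<in> dom (op_adjoint M) \<and> the (op_adjoint M y) = z \<longleftrightarrow>
      (\<forall>x\<in>dom M. the (M x) \<bullet> y = x \<bullet> z)" for y z
    using op_adjoint_eq_Some_iff[OF dense, of y z] adjoint_at_iff_inner[OF lin, of y z] by auto
  have scaleR: "M (r *\<^sub>R x) = Some (r *\<^sub>R u)" if "M x = Some u" for r x u
    using lin that unfolding linear_operator_Some_iff by (metis scaleC_of_real)
  have subspace: "subspace (Map.graph M)"
    unfolding subspace_def Map.graph_def
    using lin scaleR by (auto simp: linear_operator_Some_iff zero_prod_def)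
  show ?thesis
  proof (unfold_locales, rule adj_n)
    fix x u
    show "x \<in> dom M \<and> the (M x) = u \<longleftrightarrow>
        (\<forall>y\<in>dom (op_adjoint M). the (op_adjoint M y) \<bullet> x = y \<bullet> u)"
    proof
      assume "x \<in> dom M \<and> the (M x) = u"
      then show "\<forall>y\<in>dom (op_adjoint M). the (op_adjoint M y) \<bullet> x = y \<bullet> u"
        using adj_n by (metis inner_commute)
    next
      assume *: "\<forall>y\<in>dom (op_adjoint M). the (op_adjoint M y) \<bullet> x = y \<bullet> u"
      have "(x, u) \<in> closure (Map.graph M)"
      proof (rule in_closure_if_orthogonal[OF subspace])
        fix y assume orth: "\<And>v. v \<in> Map.graph M \<Longrightarrow> v \<bullet> y = 0"
        obtain a b where y: "y = (a, b)" by (cases y)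
        \<comment> \<open>A vector \<open>(a, b)\<close> orthogonal to the graph has
          \<open>b\<close> in the domain of the adjoint with value \<open>- a\<close>, so the
          assumption on \<open>(x, u)\<close> makes these two pairs orthogonal.\<close>
        have "\<forall>v\<in>dom M. the (M v) \<bullet> b = v \<bullet> (- a)"
          using orth[OF in_graphI] y by (fastforce simp: inner_Pair add_eq_0_iff)
        then have b: "b \<in> dom (op_adjoint M) \<and> the (op_adjoint M b) = - a" unfolding adj_n .
        then have "- a \<bullet> x = b \<bullet> u" using * by metis
        then show "(x, u) \<bullet> y = 0" using y by (simp add: inner_Pair inner_commute)
      qed
      then have "(x, u) \<in> Map.graph M" using closed by (simp add: closure_closed)
      then show "x \<in> dom M \<and> the (M x) = u" by (auto simp: Map.graph_def)
    qed
  next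
    fix x assume "x \<in> dom M" "the (M x) \<in> dom (op_adjoint M)"
    then obtain u v where u: "M x = Some u" "op_adjoint M u = Some v" by auto
    then have "(M \<circ>\<^sub>m op_adjoint M) x = Some v" unfolding normal by (simp add: map_comp_def)
    then obtain w where w: "op_adjoint M x = Some w" "M w = Some v" unfolding map_comp_Some_iff by auto
    from u w show "x \<in> dom (op_adjoint M) \<and> the (op_adjoint M x) \<in> dom M \<and>
        the (M (the (op_adjoint M x))) = the (op_adjoint M (the (M x)))"
      by auto
  next
    fix x assume "x \<in> dom (op_adjoint M)" "the (op_adjoint M x) \<in> dom M"
    then obtain u v where u: "op_adjoint M x = Some u" "M u = Some v" by auto
    then have "(op_adjoint M \<circ>\<^sub>m M) x = Some v" unfolding normal[symmetric] by (simp add: map_comp_def)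
    then obtain w where w: "M x = Some w" "op_adjoint M w = Some v" unfolding map_comp_Some_iff by auto
    from u w show "x \<in> dom M \<and> the (M x) \<in> dom (op_adjoint M) \<and>
        the (op_adjoint M (the (M x))) = the (M (the (op_adjoint M x)))"
      by auto
  next
    fix x and c :: complex assume "x \<in> dom M"
    then show "c *\<^sub>C x \<in> dom M \<and> the (M (c *\<^sub>C x)) = c *\<^sub>C the (M x)"
      using lin by (simp add: linear_operator_def)
  qed
qed

lemma op_closure_extends:
  assumes "closable N" "N x = Some u"
  shows "op_closure N x = Some u"
proof -
  have "N \<subseteq>\<^sub>m op_closure N" using op_closure(1)[OF assms(1)] by (simp add: closed_extension_def)
  then show ?thesis using assms(2) by (metis domI map_le_def)
qed

text \<open>The closure is given only as the smallest closed extension. Its restriction to the pairs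
  satisfying \<open>P\<close> is again a closed linear extension of \<open>N\<close>, hence by
  minimality all of it.\<close>

lemma op_closure_induct:
  fixes N :: "'h::complex_hilbert_space \<rightharpoonup> 'h"
  assumes N: "closable N" and closed: "closed {(x, u). P x u}"
    and base: "\<And>x u. N x = Some u \<Longrightarrow> P x u" and zero: "P 0 0"
    and add: "\<And>x u y v. P x u \<Longrightarrow> P y v \<Longrightarrow> P (x + y) (u + v)"
    and scale: "\<And>c x u. P x u \<Longrightarrow> P (c *\<^sub>C x) (c *\<^sub>C u)"
    and x: "op_closure N x = Some u"
  shows "P x u"
proof -
  define M where "M = op_closure N"
  have M: "linear_operator M" "closed (Map.graph M)"
    using op_closure(1)[OF N] by (simp_all add: M_def closed_extension_def closed_operator_def)
  define R where "R x = (if M x \<noteq> None \<and> P x (the (M x)) then M x else None)" for x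
  have R: "R x = Some u \<longleftrightarrow> M x = Some u \<and> P x u" for x u
    by (auto simp: R_def)
  have "closed_extension N R"
    unfolding closed_extension_def closed_operator_def
  proof (intro conjI)
    show "linear_operator R"
      unfolding linear_operator_Some_iff R
      using M(1) zero add scale unfolding linear_operator_Some_iff by blast
    have "Map.graph R = Map.graph M \<inter> {(x, u). P x u}"
      by (auto simp: Map.graph_def R)
    then show "closed (Map.graph R)" using M(2) closed by (simp add: closed_Int)
    show "N \<subseteq>\<^sub>m R"
    proof -
      have "R x = Some u" if "N x = Some u" for x u
        unfolding R using op_closure_extends[OF N that] base[OF that] by (simp add: M_def)
      then show ?thesis by (auto simp: map_le_def)
    qed
  qed
  then have "M \<subseteq>\<^sub>m R" unfolding M_def by (rule op_closure(2)[OF N])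
  then have "R x = Some u" using x by (metis M_def domI map_le_def)
  then show ?thesis by (simp add: R)
qed

lemma op_adjoint_op_closure:
  fixes N :: "'h::complex_hilbert_space \<rightharpoonup> 'h"
  assumes N: "closable N" "linear_operator N"
  shows "op_adjoint (op_closure N) = op_adjoint N"
proof -
  have lin: "linear_operator (op_closure N)"
    using op_closure(1)[OF N(1)] by (simp add: closed_extension_def)
  have "adjoint_at (op_closure N) y z \<longleftrightarrow> adjoint_at N y z" for y z
  proof
    assume *: "adjoint_at (op_closure N) y z"
    show "adjoint_at N y z"
      unfolding adjoint_at_def
    proof
      fix x assume "x \<in> dom N"
      then obtain u where u: "N x = Some u" by blast
      have "op_closure N x = Some u" using op_closure_extends[OF N(1) u] .
      then show "cinner (the (N x)) y = cinner x z"
        using * u unfolding adjoint_at_def by (metis domI option.sel)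
    qed
  next
    assume *: "adjoint_at N y z"
    \<comment> \<open>The two equations encode the real and imaginary parts of
      \<open>cinner u y = cinner x z\<close>. In this form the relation is closed by continuity of
      the real inner product and still stable under complex scalars.\<close>
    have "u \<bullet> y = x \<bullet> z \<and> (\<i> *\<^sub>C u) \<bullet> y = (\<i> *\<^sub>C x) \<bullet> z" if "op_closure N x = Some u" for x u
    proof (rule op_closure_induct[OF N(1) _ _ _ _ _ that, where
          P = "\<lambda>x u. u \<bullet> y = x \<bullet> z \<and> (\<i> *\<^sub>C u) \<bullet> y = (\<i> *\<^sub>C x) \<bullet> z"])
      show "closed {(x, u). u \<bullet> y = x \<bullet> z \<and> (\<i> *\<^sub>C u) \<bullet> y = (\<i> *\<^sub>C x) \<bullet> z}"
        unfolding split_def inner_scaleC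
        by (intro closed_Collect_conj closed_Collect_eq continuous_intros)
      show "v \<bullet> y = w \<bullet> z \<and> (\<i> *\<^sub>C v) \<bullet> y = (\<i> *\<^sub>C w) \<bullet> z" if "N w = Some v" for w v
      proof -
        have "N (\<i> *\<^sub>C w) = Some (\<i> *\<^sub>C v)"
          using that N(2) unfolding linear_operator_Some_iff by blast
        then show ?thesis
          using that * unfolding adjoint_at_iff_inner[OF N(2)] by (metis domI option.sel)
      qed
      fix c x u assume "u \<bullet> y = x \<bullet> z \<and> (\<i> *\<^sub>C u) \<bullet> y = (\<i> *\<^sub>C x) \<bullet> z"
      then have "cinner u y = cinner x z"
        by (intro complex_eqI) (simp_all add: cinner_scaleC_left flip: Re_cinner)
      then show "(c *\<^sub>C u) \<bullet> y = (c *\<^sub>C x) \<bullet> z \<and> (\<i> *\<^sub>C c *\<^sub>C u) \<bullet> y = (\<i> *\<^sub>C c *\<^sub>C x) \<bullet> z"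
        by (simp add: cinner_scaleC_left flip: Re_cinner)
    qed (simp_all add: scaleC_add_right inner_add_left)
    then show "adjoint_at (op_closure N) y z"
      unfolding adjoint_at_iff_inner[OF lin] by auto
  qed
  then have eq: "adjoint_at (op_closure N) = adjoint_at N" by blast
  show ?thesis unfolding op_adjoint_def eq ..
qed

section \<open>Resolvents of \<open>A\<close> from the resolvent of \<open>p(A)\<close>\<close>

lemma linear_operator_sum:
  assumes T: "linear_operator T" and "finite K" "\<And>k. k \<in> K \<Longrightarrow> T (f k) = Some (g k)"
  shows "T (\<Sum>k\<in>K. c k *\<^sub>C f k) = Some (\<Sum>k\<in>K. c k *\<^sub>C g k)"
  using assms(2,3)
proof (induction K)
  case empty
  then show ?case using T by (simp add: linear_operator_Some_iff)
next
  case (insert k K)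
  then show ?case using T unfolding linear_operator_Some_iff by simp
qed

lemma linear_operator_comp:
  assumes "linear_operator S" "linear_operator T"
  shows "linear_operator (S \<circ>\<^sub>m T)"
  using assms unfolding linear_operator_Some_iff map_comp_Some_iff by blast

lemma linear_operator_power: "linear_operator A \<Longrightarrow> linear_operator (op_power A k)"
proof (induction k)
  case (Suc k)
  then show ?case by (simp add: linear_operator_comp)
qed (simp add: linear_operator_Some_iff)

lemma linear_operator_diff:
  assumes "linear_operator T" "T x = Some u" "T y = Some v"
  shows "T (x - y) = Some (u - v)"
proof -
  have "T ((-1) *\<^sub>C y) = Some ((-1) *\<^sub>C v)" using assms unfolding linear_operator_Some_iff by blast
  then have "T (x + (-1) *\<^sub>C y) = Some (u + (-1) *\<^sub>C v)"
    using assms unfolding linear_operator_Some_iff by blast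
  then show ?thesis by (simp add: scaleC_minus_left)
qed

lemma op_power_Suc_right:
  "op_power A (Suc k) x = Some u \<longleftrightarrow> (\<exists>y. A x = Some y \<and> op_power A k y = Some u)"
  by (induction k arbitrary: u) (auto simp: map_comp_Some_iff)

lemma op_power_le: "op_power A k x = Some u \<Longrightarrow> j \<le> k \<Longrightarrow> \<exists>v. op_power A j x = Some v"
  by (induction k arbitrary: u) (auto simp: map_comp_Some_iff le_Suc_eq)

text \<open>For \<open>n = degree q\<close> this is the value of q(A) at \<open>x\<close>. It is
  meaningful for \<open>x\<close> in the domain of A^n, which lies in the domains of all lower
  powers.\<close>

definition power_sum :: "complex poly \<Rightarrow> ('h::complex_hilbert_space \<rightharpoonup> 'h) \<Rightarrow> nat \<Rightarrow> 'h \<Rightarrow> 'h" where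
  "power_sum q A n x = (\<Sum>k\<le>n. coeff q k *\<^sub>C the (op_power A k x))"

lemma op_sum_eq:
  "op_sum F n x = (if \<forall>k\<le>n. x \<in> dom (F k) then Some (\<Sum>k\<le>n. the (F k x)) else None)"
proof (induction n)
  case (Suc n)
  have "(\<forall>k\<le>Suc n. x \<in> dom (F k)) \<longleftrightarrow> (\<forall>k\<le>n. x \<in> dom (F k)) \<and> x \<in> dom (F (Suc n))"
    by (auto simp: le_Suc_eq)
  then show ?case using Suc by (auto simp: op_add_def dom_def)
qed auto

text \<open>Domains of powers decrease and \<open>op_scale\<close> keeps the domain even for
  coefficient 0, so the top power alone decides the domain of the sum.\<close>

lemma resolvent_operator_eq:
  "op_add (op_scale \<mu> Some) (op_scale (- 1) (op_poly p A)) x =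
    (if x \<in> dom (op_power A (degree p))
     then Some (power_sum ([:\<mu>:] - p) A (degree p) x) else None)"
proof (cases "x \<in> dom (op_power A (degree p))")
  case True
  then have "\<forall>k\<le>degree p. \<exists>v. op_power A k x = Some v" using op_power_le by (metis domD)
  then have "op_poly p A x = Some (\<Sum>k\<le>degree p. coeff p k *\<^sub>C the (op_power A k x))"
    unfolding op_poly_def op_sum_eq by (auto simp: op_scale_def dom_def intro!: sum.cong)
  moreover have "power_sum ([:\<mu>:] - p) A (degree p) x
      = \<mu> *\<^sub>C x - (\<Sum>k\<le>degree p. coeff p k *\<^sub>C the (op_power A k x))"
  proof -
    have "(\<Sum>k\<le>degree p. coeff [:\<mu>:] k *\<^sub>C the (op_power A k x))
        = (\<Sum>k\<le>degree p. if k = 0 then \<mu> *\<^sub>C x else 0)"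
      by (intro sum.cong refl)
        (auto simp: coeff_pCons scaleC_diff_left[of 0 0, simplified] split: nat.split)
    then show ?thesis
      by (simp add: power_sum_def scaleC_diff_left sum_subtractf)
  qed
  ultimately show ?thesis
    using True by (simp add: op_add_def op_scale_def dom_def scaleC_minus_left)
next
  case False
  then have "op_poly p A x = None"
    unfolding op_poly_def op_sum_eq by (auto simp: op_scale_def dom_def)
  then show ?thesis using False by (simp add: op_add_def op_scale_def dom_def)
qed

text \<open>\<open>B\<close> is the inverse of \<open>q(A)\<close> for \<open>q = \<mu> - p\<close>, where \<open>\<mu>\<close> is in the resolvent set of \<open>p(A)\<close>.\<close>

lemma polynomial_inverse:
  assumes deg: "0 < degree p" and spectrum: "op_spectrum (op_poly p A) \<noteq> UNIV"
  obtains q B where "degree q = degree p" "bounded_clinear B"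
    "\<And>h x. B h = x \<longleftrightarrow> x \<in> dom (op_power A (degree q)) \<and> power_sum q A (degree q) x = h"
proof -
  obtain \<mu> where "\<mu> \<in> resolvent_set (op_poly p A)"
    using spectrum unfolding op_spectrum_def by blast
  define Q where "Q = op_add (op_scale \<mu> Some) (op_scale (- 1) (op_poly p A))"
  define q where "q = [:\<mu>:] - p"
  have degree: "degree q = degree p"
    unfolding q_def using deg by (simp add: degree_diff_less degree_add_eq_right flip: add_uminus_conv_diff)
  have Q: "boundedly_invertible Q"
    using \<open>\<mu> \<in> resolvent_set _\<close> unfolding resolvent_set_def Q_def by simp
  have Q_eq: "Q x = (if x \<in> dom (op_power A (degree q)) then Some (power_sum q A (degree q) x) else None)" for x
    unfolding Q_def resolvent_operator_eq degree by (simp add: q_def)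
  define B where "B = inv_into (dom Q) (\<lambda>x. the (Q x))"
  have bij: "bij_betw (\<lambda>x. the (Q x)) (dom Q) UNIV" and bounded: "bounded_clinear B"
    using Q unfolding boundedly_invertible_def B_def by auto
  have "B h = x \<longleftrightarrow> x \<in> dom Q \<and> the (Q x) = h" for h x
    unfolding B_def using bij
    by (metis UNIV_I bij_betw_imp_inj_on bij_betw_imp_surj_on f_inv_into_f inv_into_f_f inv_into_into)
  moreover have "x \<in> dom Q \<longleftrightarrow> x \<in> dom (op_power A (degree q))" for x
    using Q_eq[of x] by (auto simp: dom_def)
  ultimately have "B h = x \<longleftrightarrow> x \<in> dom (op_power A (degree q)) \<and> power_sum q A (degree q) x = h" for h x
    using Q_eq[of x] by auto
  then show thesis using that[OF degree bounded] by blast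
qed

lemma power_sum_linear:
  assumes A: "linear_operator A"
    and x: "x \<in> dom (op_power A n)" and y: "y \<in> dom (op_power A n)"
  shows "power_sum q A n (x - c *\<^sub>C y) = power_sum q A n x - c *\<^sub>C power_sum q A n y"
proof -
  have "the (op_power A k (x - c *\<^sub>C y)) = the (op_power A k x) - c *\<^sub>C the (op_power A k y)"
    if k: "k \<le> n" for k
  proof -
    have lin: "linear_operator (op_power A k)" using A by (rule linear_operator_power)
    obtain u v where uv: "op_power A k x = Some u" "op_power A k y = Some v"
      using x y op_power_le[OF _ k] by blast
    then have "op_power A k (c *\<^sub>C y) = Some (c *\<^sub>C v)"
      using lin unfolding linear_operator_Some_iff by blast
    then show ?thesis using linear_operator_diff[OF lin uv(1)] uv by simp
  qed
  then have "power_sum q A n (x - c *\<^sub>C y) =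
      (\<Sum>k\<le>n. coeff q k *\<^sub>C (the (op_power A k x) - c *\<^sub>C the (op_power A k y)))"
    unfolding power_sum_def by (intro sum.cong) auto
  also have "\<dots> = (\<Sum>k\<le>n. coeff q k *\<^sub>C the (op_power A k x) - c *\<^sub>C coeff q k *\<^sub>C the (op_power A k y))"
    by (simp add: scaleC_diff_right scaleC_scaleC mult.commute)
  also have "\<dots> = power_sum q A n x - c *\<^sub>C power_sum q A n y"
    unfolding power_sum_def sum_subtractf scaleC_sum ..
  finally show ?thesis .
qed

lemma apply_power_sum:
  assumes A: "linear_operator A" and x: "op_power A (Suc n) x = Some v"
  shows "A (power_sum q A n x) = Some (\<Sum>k\<le>n. coeff q k *\<^sub>C the (op_power A (Suc k) x))"
  unfolding power_sum_def
proof (rule linear_operator_sum[OF A])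
  fix k assume "k \<in> {..n}"
  then obtain w where "op_power A (Suc k) x = Some w" using op_power_le[OF x, of "Suc k"] by auto
  then show "A (the (op_power A k x)) = Some (the (op_power A (Suc k) x))"
    by (auto simp: map_comp_Some_iff)
qed simp

text \<open>With \<open>q = [:- \<nu>, 1:] * r\<close>, an eigenvector for \<open>\<nu>\<close>
  would be annihilated by q(A), and r(A) applied to \<open>B h\<close> solves (A - \<nu>) x = h.
  This makes A - \<nu> bijective without any claim of continuity for the inverse.\<close>

lemma resolvent_of_root:
  assumes A: "linear_operator A" and deg: "0 < degree q"
    and B: "\<And>h x. B h = x \<longleftrightarrow> x \<in> dom (op_power A (degree q)) \<and> power_sum q A (degree q) x = h"
  obtains \<nu> R where "\<And>h x. R h = x \<longleftrightarrow> A x = Some (h + \<nu> *\<^sub>C x)" "\<And>h. B (R h) = R (B h)"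
proof -
  define n where "n = degree q - 1"
  have n: "degree q = Suc n" using deg by (simp add: n_def)
  obtain \<nu> where "poly q \<nu> = 0"
    using fundamental_theorem_of_algebra[of q] deg by (auto simp: constant_degree)
  then obtain r where r: "q = [:- \<nu>, 1:] * r" using poly_eq_0_iff_dvd by (metis dvdE)
  have "r \<noteq> 0" using r deg by auto
  then have "degree q = degree [:- \<nu>, 1:] + degree r" unfolding r by (intro degree_mult_eq) auto
  then have deg_r: "degree r = n" using n by simp
  have coeff_0: "coeff q 0 = - (\<nu> * coeff r 0)" and
    coeff_Suc: "coeff q (Suc k) = coeff r k - \<nu> * coeff r (Suc k)" for k
    unfolding r by simp_all
  have B_zero: "B 0 = 0"
  proof -
    have "linear_operator (op_power A (degree q))" using A by (rule linear_operator_power)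
    then have 0: "0 \<in> dom (op_power A (degree q))" by (simp add: linear_operator_def)
    have "power_sum q A (degree q) (0 - 1 *\<^sub>C 0) = 0"
      by (subst power_sum_linear[OF A 0 0]) simp
    then show ?thesis unfolding B using 0 by simp
  qed
  have inj: "x = 0" if x: "A x = Some (\<nu> *\<^sub>C x)" for x
  proof -
    have pow: "op_power A k x = Some (\<nu> ^ k *\<^sub>C x)" for k
    proof (induction k)
      case (Suc k)
      have "A (\<nu> ^ k *\<^sub>C x) = Some (\<nu> ^ k *\<^sub>C \<nu> *\<^sub>C x)"
        using A x unfolding linear_operator_Some_iff by blast
      then show ?case using Suc by (simp add: map_comp_Some_iff scaleC_scaleC mult.commute)
    qed simp
    have "power_sum q A (degree q) x = poly q \<nu> *\<^sub>C x"
    proof -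
      have "(\<Sum>k\<in>K. f k *\<^sub>C x) = (\<Sum>k\<in>K. f k) *\<^sub>C x" if "finite K" for K and f :: "nat \<Rightarrow> complex"
        using that scaleC_diff_left[of 0 0 x] by induction (simp_all add: scaleC_add_left)
      then show ?thesis by (simp add: power_sum_def pow poly_altdef scaleC_scaleC)
    qed
    also have "\<dots> = 0" using \<open>poly q \<nu> = 0\<close> scaleC_diff_left[of 0 0 x] by simp
    finally have "B 0 = x" unfolding B using pow by auto
    then show ?thesis using B_zero by simp
  qed
  have surj: "\<exists>x. A x = Some (h + \<nu> *\<^sub>C x)" for h
  proof -
    define x where "x = B h"
    have x: "x \<in> dom (op_power A (degree q))" "power_sum q A (degree q) x = h"
      using B[of h x] x_def by auto
    then obtain v where v: "op_power A (Suc n) x = Some v" unfolding n by blast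
    let ?a = "\<lambda>k. the (op_power A k x)"
    have "h = coeff q 0 *\<^sub>C ?a 0 + (\<Sum>k\<le>n. coeff q (Suc k) *\<^sub>C ?a (Suc k))"
      using x(2) unfolding power_sum_def n sum.atMost_Suc_shift by simp
    also have "\<dots> = (\<Sum>k\<le>n. coeff r k *\<^sub>C ?a (Suc k))
        - ((\<nu> * coeff r 0) *\<^sub>C ?a 0 + (\<Sum>k\<le>n. (\<nu> * coeff r (Suc k)) *\<^sub>C ?a (Suc k)))"
      unfolding coeff_0 coeff_Suc scaleC_diff_left sum_subtractf scaleC_minus_left by simp
    also have "(\<nu> * coeff r 0) *\<^sub>C ?a 0 + (\<Sum>k\<le>n. (\<nu> * coeff r (Suc k)) *\<^sub>C ?a (Suc k))
        = (\<Sum>k\<le>Suc n. (\<nu> * coeff r k) *\<^sub>C ?a k)"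
      unfolding sum.atMost_Suc_shift by simp
    \<comment> \<open>The coefficient of \<open>r\<close> at \<open>Suc n\<close> vanishes, so the
      sum stops at \<open>n\<close>.\<close>
    also have "\<dots> = (\<Sum>k\<le>n. \<nu> *\<^sub>C coeff r k *\<^sub>C ?a k)"
      using deg_r scaleC_diff_left[of 0 0] by (simp add: coeff_eq_0 scaleC_scaleC)
    also have "\<dots> = \<nu> *\<^sub>C power_sum r A n x"
      unfolding power_sum_def scaleC_sum ..
    finally have "A (power_sum r A n x) = Some (h + \<nu> *\<^sub>C power_sum r A n x)"
      using apply_power_sum[OF A v, of r] by simp
    then show ?thesis by blast
  qed
  then obtain R where R: "\<And>h. A (R h) = Some (h + \<nu> *\<^sub>C R h)" by metis
  have R_iff: "R h = x \<longleftrightarrow> A x = Some (h + \<nu> *\<^sub>C x)" for h x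
  proof
    assume x: "A x = Some (h + \<nu> *\<^sub>C x)"
    have "R h - x = 0"
      using linear_operator_diff[OF A R[of h] x] by (intro inj) (simp add: scaleC_diff_right)
    then show "R h = x" by simp
  qed (use R in auto)
  have "B (R h) = R (B h)" for h
  proof -
    define x where "x = B h"
    define y where "y = R x"
    have x: "x \<in> dom (op_power A (degree q))" "power_sum q A (degree q) x = h"
      using B[of h x] x_def by auto
    have y: "A y = Some (x + \<nu> *\<^sub>C y)" unfolding y_def by (rule R)
    \<comment> \<open>Since \<open>A y = x + \<nu> *\<^sub>C y\<close>, every power defined at
      \<open>x\<close> and \<open>y\<close> gives one more at \<open>y\<close>. The extra power
      beyond \<open>degree q\<close> is what lets A and q(A) be exchanged at
      \<open>y\<close>.\<close>
    have "k \<le> Suc (degree q) \<Longrightarrow> y \<in> dom (op_power A k)" for k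
    proof (induction k)
      case (Suc k)
      have lin: "linear_operator (op_power A k)" using A by (rule linear_operator_power)
      have "x \<in> dom (op_power A k)" "y \<in> dom (op_power A k)"
        using x(1) Suc op_power_le[where j = k] by (auto simp: dom_def)
      then have "x + \<nu> *\<^sub>C y \<in> dom (op_power A k)" using lin by (simp add: linear_operator_def)
      then show ?case using y op_power_Suc_right[of A k y] by auto
    qed auto
    then obtain v where v: "op_power A (Suc (degree q)) y = Some v" by blast
    then have y_dom: "y \<in> dom (op_power A (degree q))" using op_power_le[OF v, of "degree q"] by auto
    have xy_dom: "x + \<nu> *\<^sub>C y \<in> dom (op_power A (degree q))"
      using v y unfolding op_power_Suc_right by auto
    have "the (op_power A (Suc k) y) = the (op_power A k (x + \<nu> *\<^sub>C y))" if k: "k \<le> degree q" for k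
    proof -
      obtain w where "op_power A (Suc k) y = Some w" using op_power_le[OF v, of "Suc k"] k by auto
      moreover from this have "op_power A k (x + \<nu> *\<^sub>C y) = Some w"
        using y unfolding op_power_Suc_right by auto
      ultimately show ?thesis by simp
    qed
    then have "A (power_sum q A (degree q) y) = Some (power_sum q A (degree q) (x + \<nu> *\<^sub>C y))"
      unfolding apply_power_sum[OF A v] by (simp add: power_sum_def)
    also have "power_sum q A (degree q) (x + \<nu> *\<^sub>C y) = h + \<nu> *\<^sub>C power_sum q A (degree q) y"
      using power_sum_linear[OF A xy_dom y_dom, of q \<nu>] x(2) by (simp add: algebra_simps)
    finally have "power_sum q A (degree q) y = R h" using R_iff by metis
    then have "B (R h) = y" unfolding B using y_dom by simp
    then show ?thesis by (simp add: y_def x_def)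
  qed
  with R_iff show thesis by (rule that)
qed

text \<open>For \<open>x = B y\<close> the hypothesis \<open>comm\<close> can be used at A^k x only
  if \<open>N\<close> is defined at A^(k+1) x. Below the top power this follows from the inclusion
  of domains; at the top power it has to be recovered from \<open>y\<close>.\<close>

lemma inverse_commutes:
  assumes A: "linear_operator A" and N: "linear_operator N" and deg: "0 < degree q"
    and dom: "dom A \<subseteq> dom N" and comm: "N \<circ>\<^sub>m A \<subseteq>\<^sub>m A \<circ>\<^sub>m N"
    and B: "\<And>h x. B h = x \<longleftrightarrow> x \<in> dom (op_power A (degree q)) \<and> power_sum q A (degree q) x = h"
    and y: "N y = Some u"
  shows "N (B y) = Some (B u)"
proof -
  define x where "x = B y"
  define n where "n = degree q - 1"
  have n: "degree q = Suc n" using deg by (simp add: n_def)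
  have x: "x \<in> dom (op_power A (degree q))" "power_sum q A (degree q) x = y"
    using B[of y x] x_def by auto
  let ?a = "\<lambda>k. the (op_power A k x)"
  have a: "op_power A k x = Some (?a k)" if "k \<le> degree q" for k
  proof -
    obtain v where "op_power A (degree q) x = Some v" using x(1) by blast
    from op_power_le[OF this that] show ?thesis by auto
  qed
  have N_Some: "N z = Some (the (N z))" if "z \<in> dom N" for z
    using that by auto
  have N_a: "?a k \<in> dom N" if "k \<le> n" for k
  proof -
    have "op_power A (Suc k) x = Some (?a (Suc k))" using a[of "Suc k"] that unfolding n by (simp del: op_power.simps)
    then have "?a k \<in> dom A" by (auto simp: map_comp_Some_iff)
    then show ?thesis using dom by blast
  qed
  \<comment> \<open>Solve y = q(A) x for the top power: the leading coefficient is nonzero, and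
    \<open>y\<close> and the lower powers lie in \<open>dom N\<close>.\<close>
  moreover have "?a (Suc n) \<in> dom N"
  proof -
    let ?c = "coeff q (Suc n)"
    have "?c \<noteq> 0" using n deg by (metis degree_0 leading_coeff_0_iff less_irrefl)
    have "N (\<Sum>k\<le>n. coeff q k *\<^sub>C ?a k) = Some (\<Sum>k\<le>n. coeff q k *\<^sub>C the (N (?a k)))"
      by (intro linear_operator_sum[OF N] N_Some N_a) auto
    from linear_operator_diff[OF N y this]
    have "?c *\<^sub>C ?a (Suc n) \<in> dom N" using x(2) unfolding power_sum_def n by auto
    then have "inverse ?c *\<^sub>C ?c *\<^sub>C ?a (Suc n) \<in> dom N" using N by (simp add: linear_operator_def)
    then show ?thesis using \<open>?c \<noteq> 0\<close> by (simp add: scaleC_scaleC)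
  qed
  ultimately have N_a: "?a k \<in> dom N" if "k \<le> degree q" for k using that n le_Suc_eq by metis
  obtain v where v: "N x = Some v" using N_a[of 0] by auto
  have pow: "k \<le> degree q \<Longrightarrow> op_power A k v = N (?a k)" for k
  proof (induction k)
    case (Suc k)
    have b: "A (?a k) = Some (?a (Suc k))"
      using a[OF Suc.prems] a[of k] Suc.prems by (auto simp: map_comp_Some_iff)
    obtain c where c: "N (?a (Suc k)) = Some c" using N_a[OF Suc.prems] by blast
    with b have "(N \<circ>\<^sub>m A) (?a k) = Some c" by (simp add: map_comp_Some_iff)
    then have "(A \<circ>\<^sub>m N) (?a k) = Some c" using comm by (metis domI map_le_def)
    then obtain w where "N (?a k) = Some w" "A w = Some c" unfolding map_comp_Some_iff by blast
    then show ?case using Suc c by (simp add: map_comp_Some_iff del: map_comp_simps)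
  qed (use v in simp)
  have "N (\<Sum>k\<le>degree q. coeff q k *\<^sub>C ?a k) = Some (\<Sum>k\<le>degree q. coeff q k *\<^sub>C the (N (?a k)))"
    by (intro linear_operator_sum[OF N] N_Some N_a) auto
  then have "u = (\<Sum>k\<le>degree q. coeff q k *\<^sub>C the (N (?a k)))"
    using x(2) y unfolding power_sum_def by simp
  then have "power_sum q A (degree q) v = u" unfolding power_sum_def using pow by simp
  moreover have "v \<in> dom (op_power A (degree q))" using pow[of "degree q"] N_a[of "degree q"] by auto
  ultimately have "B u = v" unfolding B by simp
  then show ?thesis using v x_def by simp
qed

theorem theorem3p4:
  fixes p :: "complex poly" and N A :: "'h::complex_hilbert_space \<rightharpoonup> 'h"
  assumes "degree p > 0"
    and "linear_operator N" "densely_defined N" "closable N"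
    and "normal_operator (op_closure N)"
    and "linear_operator A" "densely_defined A"
    and "op_spectrum (op_poly p A) \<noteq> UNIV"
    and "dom A \<subseteq> dom N"
    and "N \<circ>\<^sub>m A \<subseteq>\<^sub>m A \<circ>\<^sub>m N"
  shows "op_adjoint N \<circ>\<^sub>m A \<subseteq>\<^sub>m A \<circ>\<^sub>m op_adjoint N"
proof -
  note N = \<open>linear_operator N\<close> and A = \<open>linear_operator A\<close> and cl = \<open>closable N\<close>
  define M where "M = op_closure N"
  define m where "m x = the (M x)" for x
  define n where "n x = the (op_adjoint N x)" for x
  have adj: "op_adjoint M = op_adjoint N" unfolding M_def by (rule op_adjoint_op_closure[OF cl N])
  interpret normal_pair "dom M" "dom (op_adjoint N)" m n
    using normal_operator_pair[of M] assms(5) unfolding adj m_def n_def M_def[symmetric] by simp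
  have ext: "M x = Some u" if "N x = Some u" for x u
    unfolding M_def using op_closure_extends[OF cl that] .
  obtain q B where q: "degree q = degree p" and bounded: "bounded_clinear B"
    and B: "\<And>h x. B h = x \<longleftrightarrow> x \<in> dom (op_power A (degree q)) \<and> power_sum q A (degree q) x = h"
    by (rule polynomial_inverse[OF assms(1,8)]) (rule that)
  have deg: "0 < degree q" using q assms(1) by simp
  obtain \<nu> R where R: "\<And>h x. R h = x \<longleftrightarrow> A x = Some (h + \<nu> *\<^sub>C x)"
    and BR: "\<And>h. B (R h) = R (B h)"
    by (rule resolvent_of_root[OF A deg B]) (rule that)
  have AR: "A (R h) = Some (h + \<nu> *\<^sub>C R h)" for h using R by blast
  have R_in: "\<exists>v. N (R h) = Some v" for h using AR assms(9) by blast
  \<comment> \<open>A positive degree puts the range of \<open>B\<close> into \<open>dom A\<close>,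
    hence into \<open>dom N\<close>.\<close>
  have B_in: "\<exists>v. N (B h) = Some v" for h
  proof -
    have "B h \<in> dom (op_power A (degree q))" using B by blast
    then have "B h \<in> dom A" using deg op_power_le[of A "degree q" "B h" _ 1] by auto
    then show ?thesis using assms(9) by blast
  qed
  have BN: "N (B y) = Some (B u)" if "N y = Some u" for y u
    by (rule inverse_commutes[OF A N deg assms(9,10) B that])
  \<comment> \<open>By continuity of \<open>B\<close> the relation is closed, so it passes from
    \<open>N\<close> to its closure.\<close>
  have BM: "M (B y) = Some (B u)" if y: "M y = Some u" for y u
  proof (rule op_closure_induct[OF cl _ _ _ _ _ y[unfolded M_def]])
    have BL: "bounded_linear B" and B_scale: "\<And>c x. B (c *\<^sub>C x) = c *\<^sub>C B x"
      using bounded by (auto simp: bounded_clinear_def)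
    have M: "linear_operator M" "closed (Map.graph M)"
      using op_closure(1)[OF cl] by (simp_all add: M_def closed_extension_def closed_operator_def)
    have "{(x, u). M (B x) = Some (B u)} = (\<lambda>z. (B (fst z), B (snd z))) -` Map.graph M"
      by (auto simp: Map.graph_def)
    moreover have "closed \<dots>"
      using M(2) by (intro closed_vimage continuous_intros bounded_linear.continuous_on[OF BL])
    ultimately show "closed {(x, u). M (B x) = Some (B u)}" by simp
    show "M (B x) = Some (B u)" if "N x = Some u" for x u using ext BN that by blast
    show "M (B 0) = Some (B 0)"
      using M(1) by (simp add: linear_operator_Some_iff linear_0[OF bounded_linear.linear[OF BL]])
    show "M (B (x + y)) = Some (B (u + v))"
      if "M (B x) = Some (B u)" "M (B y) = Some (B v)" for x u y v
      using M(1) that unfolding linear_operator_Some_iff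
      by (simp add: linear_add[OF bounded_linear.linear[OF BL]])
    show "M (B (c *\<^sub>C x)) = Some (B (c *\<^sub>C u))" if "M (B x) = Some (B u)" for c x u
      using M(1) that unfolding linear_operator_Some_iff by (simp add: B_scale)
  qed
  have B_inj: "h = h'" if "B h = B h'" for h h' using B that by metis
  have R_add: "R (x + y) = R x + R y" for x y
  proof -
    have "A (R x + R y) = Some ((x + \<nu> *\<^sub>C R x) + (y + \<nu> *\<^sub>C R y))"
      using A AR unfolding linear_operator_Some_iff by blast
    then show ?thesis unfolding R by (simp add: scaleC_add_right algebra_simps)
  qed
  have R_scale: "R (c *\<^sub>C x) = c *\<^sub>C R x" for c x
  proof -
    have "A (c *\<^sub>C R x) = Some (c *\<^sub>C (x + \<nu> *\<^sub>C R x))"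
      using A AR unfolding linear_operator_Some_iff by blast
    then show ?thesis unfolding R by (simp add: scaleC_add_right scaleC_scaleC mult.commute)
  qed
  \<comment> \<open>\<open>R\<close> need not be continuous, so \<open>R N \<subseteq> N R\<close> cannot be extended to \<open>M\<close> by taking limits;
    it is transported along the injective \<open>B\<close> instead.\<close>
  have RM: "R y \<in> dom M \<and> R (m y) = m (R y)" if y: "y \<in> dom M" for y
  proof -
    obtain u where u: "M y = Some u" using y by blast
    obtain v where v: "N (R y) = Some v" using R_in by blast
    have NRB: "N (R (B y)) = Some (B v)" using BN[OF v] by (simp add: BR)
    obtain w where w: "N (B y) = Some w" using B_in by blast
    \<comment> \<open>\<open>M\<close> extends \<open>N\<close>, so \<open>BM\<close> determines the
      value of \<open>N\<close> at \<open>B y\<close>, although \<open>y\<close> itself need not lie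
      in \<open>dom N\<close>.\<close>
    have "w = B u" using ext[OF w] BM[OF u] by simp
    \<comment> \<open>The image of \<open>R (B y)\<close> under \<open>A\<close> is
      \<open>B y + \<nu> *\<^sub>C R (B y)\<close>, a sum of two vectors of \<open>dom N\<close>, so
      the inclusion assumed for \<open>N\<close> is applicable at this point.\<close>
    have "(N \<circ>\<^sub>m A) (R (B y)) = Some (w + \<nu> *\<^sub>C B v)"
    proof -
      have "N (B y + \<nu> *\<^sub>C R (B y)) = Some (w + \<nu> *\<^sub>C B v)"
        using N w NRB unfolding linear_operator_Some_iff by blast
      then show ?thesis by (simp add: map_comp_Some_iff AR)
    qed
    then have "(A \<circ>\<^sub>m N) (R (B y)) = Some (w + \<nu> *\<^sub>C B v)"
      using assms(10) unfolding map_le_def by (metis domI)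
    then have "A (B v) = Some (B u + \<nu> *\<^sub>C B v)"
      unfolding map_comp_Some_iff by (simp add: NRB \<open>w = B u\<close>)
    then have "R (B u) = B v" unfolding R .
    then have "R u = v" using BR B_inj by metis
    then show ?thesis using ext[OF v] u by (auto simp: m_def)
  qed
  show ?thesis
    unfolding map_le_def
  proof
    fix x assume "x \<in> dom (op_adjoint N \<circ>\<^sub>m A)"
    then obtain a b where a: "A x = Some a" and b: "op_adjoint N a = Some b"
      by (auto simp: map_comp_Some_iff)
    obtain u where "N x = Some u" using a assms(9) by blast
    then have "x \<in> dom M" using ext by blast
    have "a \<in> dom M" using b D_eq_E by blast
    \<comment> \<open>With y = (A - \<nu>) x one has \<open>x = R y\<close>, and exchanging
      \<open>R\<close> with the adjoint at \<open>y\<close> becomes the claim at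
      \<open>x\<close>.\<close>
    define y where "y = a - \<nu> *\<^sub>C x"
    have x: "x = R y" using R[of y x] a by (simp add: y_def)
    have "\<nu> *\<^sub>C x \<in> dom M" using m_scaleC \<open>x \<in> dom M\<close> by blast
    then have y: "y \<in> dom M" unfolding y_def using m_diff \<open>a \<in> dom M\<close> by blast
    have "n y = b - \<nu> *\<^sub>C n x"
    proof -
      interpret sw: normal_pair "dom (op_adjoint N)" "dom M" n m by (rule swap)
      have "n y = n a - n (\<nu> *\<^sub>C x)"
        unfolding y_def using sw.m_diff \<open>a \<in> dom M\<close> \<open>\<nu> *\<^sub>C x \<in> dom M\<close> D_eq_E by blast
      then show ?thesis using n_scaleC[of x \<nu>] \<open>x \<in> dom M\<close> D_eq_E b by (simp add: n_def)
    qed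
    then have ny: "n y + \<nu> *\<^sub>C n x = b" by simp
    have nx: "n x = R (n y)"
      unfolding x by (rule algebraic_fuglede[OF R_add R_scale RM y, symmetric])
    have "A (n x) = Some b" using AR[of "n y"] unfolding nx[symmetric] ny .
    moreover have "op_adjoint N x = Some (n x)"
    proof -
      have "x \<in> dom (op_adjoint N)" using \<open>x \<in> dom M\<close> D_eq_E by simp
      then show ?thesis by (auto simp: n_def)
    qed
    ultimately show "(op_adjoint N \<circ>\<^sub>m A) x = (A \<circ>\<^sub>m op_adjoint N) x"
      using a b by (simp add: map_comp_def)
  qed
qed

end
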